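(* There exists a polynomial-time algorithm that, given an instance of the weighted utility problem, i.e., a finite set of bid values $\mathcal{B}^c=\{\bar b^c_1,\dots,\bar b^c_d\}\subset[0,1]$ with $\bar b^c_1\ge\dots\ge\bar b^c_d$, weights $\hat y_i\ge 0$ for $i\in N_c$, and $\hat x\ge 0$, together with an ad auction (with either the GSP or the VCG mechanism) in which the external bids are drawn from a distribution $\gamma^e$, computes a bidding strategy $b^c\in\bar B^c:=(\mathcal{B}^c)^{n_c}$ attaining $$\max_{b^c\in\bar B^c}\ \sum_{i\in N_c}\bigl(\hat y_i\,\tilde r_i(b^c)-\hat x\,\tilde\pi_i(b^c)\bigr).$$
   Context: Ad auction. There are colluders $N_c=\{1,\dots,n_c\}$ and external agents $N_e=\{1,\dots,n_e\}$, $n=n_c+n_e$ agents in total, and slots $\{1,\dots,m\}$, $m\le n$, with click-through rates $1\ge\lambda_1\ge\dots\ge\lambda_m\ge 0$; set $\lambda_k=0$ for $k>m$. Agent $i$ has valuation $v_i\in[0,1]$. A bidding strategy is a vector $b^c\in[0,1]^{n_c}$ of colluders' bids; $b^e\in[0,1]^{n_e}$ is the vector of external bids. Given the full bid profile $b=(b^c,b^e)$, agents are ranked by decreasing bid, and the agent ranked $k$-th gets slot $k$ for $k\le m$ (agents ranked below $m$ get no slot). Ties between a colluder and an external agent are broken in favor of the colluder; ties among colluders are broken by a fixed order, namely by index, with the colluders indexed so that $\hat y_1v_1\ge\dots\ge\hat y_{n_c}v_{n_c}$. Write $b_{(k)}$ for the $k$-th highest bid ($b_{(n+1)}=0$). An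 agent $i$ ranked $k$-th has expected revenue $r_i(b)=\lambda_k v_i$, and expected payment - GSP mechanism: $\pi_i(b)=\lambda_k b_{(k+1)}$; - VCG mechanism: $\pi_i(b)=\sum_{j=k+1}^{m+1}b_{(j)}(\lambda_{j-1}-\lambda_j)$ if $k\le m$, and $0$ otherwise. The external profile $b^e$ is drawn from a probability distribution $\gamma^e$; $\tilde r_i(b^c)=\mathbb{E}_{b^e\sim\gamma^e}[r_i(b^c,b^e)]$ and $\tilde\pi_i(b^c)=\mathbb{E}_{b^e\sim\gamma^e}[\pi_i(b^c,b^e)]$. Computational model: the algorithm has access to an oracle that, on input a bidding strategy $b^c$, returns the values $\tilde r_i(b^c)$ and $\tilde\pi_i(b^c)$ for $i\in N_c$ (one call counts as one step). "Polynomial time" means polynomial in the size of the instance (including $n$, $m$, $d$ and the binary encoding of the numerical data). *)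

theory Defs
  imports
    "HOL-Probability.Probability"
    "HOL-Library.Log_Nat"
    "HOL-Computational_Algebra.Polynomial"
begin

section \<open>Ad auctions with colluders\<close>

text \<open>
  All agents, slots, ranks and bid values are numbered from 1. In a full bid profile, agents
  \<open>1..n\<^sub>c\<close> are the colluders and agent \<open>n\<^sub>c + j\<close> is external agent \<open>j\<close>.
  \<open>slot_ctr\<close>, \<open>valuation\<close>, \<open>bid_val\<close> and \<open>y_wt\<close> only matter on
  \<open>{1..m}\<close>, \<open>{1..n}\<close>, \<open>{1..d}\<close> and \<open>{1..n\<^sub>c}\<close>, respectively.
\<close>

datatype mechanism = GSP | VCG

record wu_instance =
  mech :: mechanism
  n_col :: nat
  n_ext :: nat
  n_slots :: nat
  n_bids :: nat
  slot_ctr :: "nat \<Rightarrow> real"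
  valuation :: "nat \<Rightarrow> real"
  bid_val :: "nat \<Rightarrow> real"
  y_wt :: "nat \<Rightarrow> real"
  x_wt :: real
  ext_dist :: "(nat \<Rightarrow> real) measure"

definition n_agents :: "wu_instance \<Rightarrow> nat" where
  "n_agents I = n_col I + n_ext I"

definition valid_instance :: "wu_instance \<Rightarrow> bool" where
  "valid_instance I \<longleftrightarrow>
     n_slots I \<le> n_agents I \<and> 1 \<le> n_bids I \<and>
     slot_ctr I ` {1..n_slots I} \<subseteq> {0..1} \<and> antimono_on {1..n_slots I} (slot_ctr I) \<and>
     valuation I ` {1..n_agents I} \<subseteq> {0..1} \<and>
     bid_val I ` {1..n_bids I} \<subseteq> {0..1} \<and> antimono_on {1..n_bids I} (bid_val I) \<and>
     (\<forall>i\<in>{1..n_col I}. 0 \<le> y_wt I i) \<and> 0 \<le> x_wt I \<and>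
     antimono_on {1..n_col I} (\<lambda>i. y_wt I i * valuation I i) \<and>
     prob_space (ext_dist I) \<and>
     sets (ext_dist I) = sets (Pi\<^sub>M {1..n_ext I} (\<lambda>_. borel)) \<and>
     (AE be in ext_dist I. \<forall>j\<in>{1..n_ext I}. be j \<in> {0..1})"

definition ctr :: "wu_instance \<Rightarrow> nat \<Rightarrow> real" where
  "ctr I k = (if k \<le> n_slots I then slot_ctr I k else 0)"

definition profile :: "wu_instance \<Rightarrow> (nat \<Rightarrow> real) \<Rightarrow> (nat \<Rightarrow> real) \<Rightarrow> nat \<Rightarrow> real" where
  "profile I bc be i = (if i \<le> n_col I then bc i else be (i - n_col I))"

text \<open>
  Ties go to the smaller agent number. As the colluders come first, this favours colluders over
  external agents and breaks ties among colluders by index. (The order among tied external agents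
  has no influence on the colluders.)
\<close>

definition precedes :: "(nat \<Rightarrow> real) \<Rightarrow> nat \<Rightarrow> nat \<Rightarrow> bool" where
  "precedes b j i \<longleftrightarrow> b j > b i \<or> (b j = b i \<and> j < i)"

definition agent_rank :: "wu_instance \<Rightarrow> (nat \<Rightarrow> real) \<Rightarrow> nat \<Rightarrow> nat" where
  "agent_rank I b i = 1 + card {j \<in> {1..n_agents I}. precedes b j i}"

definition kth_bid :: "wu_instance \<Rightarrow> (nat \<Rightarrow> real) \<Rightarrow> nat \<Rightarrow> real" where
  "kth_bid I b k =
     (if k \<in> {1..n_agents I} then rev (sort (map b [1..<Suc (n_agents I)])) ! (k - 1) else 0)"

definition revenue :: "wu_instance \<Rightarrow> (nat \<Rightarrow> real) \<Rightarrow> nat \<Rightarrow> real" where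
  "revenue I b i = ctr I (agent_rank I b i) * valuation I i"

definition gsp_payment :: "wu_instance \<Rightarrow> (nat \<Rightarrow> real) \<Rightarrow> nat \<Rightarrow> real" where
  "gsp_payment I b i = ctr I (agent_rank I b i) * kth_bid I b (agent_rank I b i + 1)"

definition vcg_payment :: "wu_instance \<Rightarrow> (nat \<Rightarrow> real) \<Rightarrow> nat \<Rightarrow> real" where
  "vcg_payment I b i =
     (let k = agent_rank I b i in
      if k \<le> n_slots I
      then \<Sum>j = k + 1..n_slots I + 1. kth_bid I b j * (ctr I (j - 1) - ctr I j)
      else 0)"

definition payment :: "wu_instance \<Rightarrow> (nat \<Rightarrow> real) \<Rightarrow> nat \<Rightarrow> real" where
  "payment I = (case mech I of GSP \<Rightarrow> gsp_payment I | VCG \<Rightarrow> vcg_payment I)"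

definition exp_revenue :: "wu_instance \<Rightarrow> (nat \<Rightarrow> real) \<Rightarrow> nat \<Rightarrow> real" where
  "exp_revenue I bc i = (\<integral>be. revenue I (profile I bc be) i \<partial>ext_dist I)"

definition exp_payment :: "wu_instance \<Rightarrow> (nat \<Rightarrow> real) \<Rightarrow> nat \<Rightarrow> real" where
  "exp_payment I bc i = (\<integral>be. payment I (profile I bc be) i \<partial>ext_dist I)"

definition bid_grid :: "wu_instance \<Rightarrow> (nat \<Rightarrow> real) set" where
  "bid_grid I = (\<Pi>\<^sub>E i\<in>{1..n_col I}. bid_val I ` {1..n_bids I})"

definition weighted_utility :: "wu_instance \<Rightarrow> (nat \<Rightarrow> real) \<Rightarrow> real" where
  "weighted_utility I bc =
     (\<Sum>i = 1..n_col I. y_wt I i * exp_revenue I bc i - x_wt I * exp_payment I bc i)"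


section \<open>Computational model: random access programs with an oracle\<close>

text \<open>
  A program has countably many arrays of natural numbers (for indices and control) and countably
  many arrays of numerical data. The arrays of either sort are named by natural numbers; all cells
  are initially 0, except for those holding the input. Programs are finite syntactic objects and do
  not depend on the instance.
\<close>

datatype nexp =
    NConst nat
  | NGet nat nexp
  | NAdd nexp nexp
  | NSub nexp nexp
  | NMul nexp nexp

datatype rexp =
    RNat nexp
  | RGet nat nexp
  | RAdd rexp rexp
  | RSub rexp rexp
  | RMul rexp rexp

datatype bexp =
    NLess nexp nexp
  | RLess rexp rexp
  | BNot bexp
  | BAnd bexp bexp

text \<open>
  \<open>NAssign a e e'\<close> stores \<open>e'\<close> in cell \<open>e\<close> of array \<open>a\<close>, and likewise
  \<open>RAssign\<close>. \<open>Query a r p\<close> calls the oracle on the strategy stored in cells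
  \<open>1..n\<^sub>c\<close> of the numerical array \<open>a\<close>, and stores the expected revenues and payments
  in the numerical arrays \<open>r\<close> and \<open>p\<close>.
\<close>

datatype com =
    Skip
  | NAssign nat nexp nexp
  | RAssign nat nexp rexp
  | Seq com com
  | If bexp com com
  | While bexp com
  | Query nat nat nat

record state =
  narr :: "nat \<Rightarrow> nat \<Rightarrow> nat"
  rarr :: "nat \<Rightarrow> nat \<Rightarrow> real"

primrec nval :: "nexp \<Rightarrow> state \<Rightarrow> nat" where
  "nval (NConst k) s = k"
| "nval (NGet a e) s = narr s a (nval e s)"
| "nval (NAdd e e') s = nval e s + nval e' s"
| "nval (NSub e e') s = nval e s - nval e' s"
| "nval (NMul e e') s = nval e s * nval e' s"

primrec rval :: "rexp \<Rightarrow> state \<Rightarrow> real" where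
  "rval (RNat e) s = real (nval e s)"
| "rval (RGet a e) s = rarr s a (nval e s)"
| "rval (RAdd e e') s = rval e s + rval e' s"
| "rval (RSub e e') s = rval e s - rval e' s"
| "rval (RMul e e') s = rval e s * rval e' s"

primrec bval :: "bexp \<Rightarrow> state \<Rightarrow> bool" where
  "bval (NLess e e') s \<longleftrightarrow> nval e s < nval e' s"
| "bval (RLess e e') s \<longleftrightarrow> rval e s < rval e' s"
| "bval (BNot b) s \<longleftrightarrow> \<not> bval b s"
| "bval (BAnd b b') s \<longleftrightarrow> bval b s \<and> bval b' s"

text \<open>
  Logarithmic cost: evaluating a node of an expression costs the length of its value, on top of the
  cost of the subexpressions. The length of numerical data is given by the parameter \<open>sz\<close>.
  It is either \<open>rat_len\<close>, the length of the binary encoding of a rational number, or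
  \<open>unit_len\<close>, where arbitrary real numbers are atomic and have length 1. Natural numbers
  (indices and counters) are always charged by their binary length.
\<close>

definition nat_len :: "nat \<Rightarrow> nat" where
  "nat_len k = 1 + floorlog 2 k"

definition unit_len :: "real \<Rightarrow> nat" where
  "unit_len x = 1"

definition rat_len :: "real \<Rightarrow> nat" where
  "rat_len x =
     (let (p, q) = quotient_of (THE r. x = of_rat r) in 1 + nat_len (nat \<bar>p\<bar>) + nat_len (nat q))"

primrec ncost :: "nexp \<Rightarrow> state \<Rightarrow> nat" where
  "ncost (NConst k) s = nat_len k"
| "ncost (NGet a e) s = ncost e s + nat_len (narr s a (nval e s))"
| "ncost (NAdd e e') s = ncost e s + ncost e' s + nat_len (nval e s + nval e' s)"
| "ncost (NSub e e') s = ncost e s + ncost e' s + nat_len (nval e s - nval e' s)"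
| "ncost (NMul e e') s = ncost e s + ncost e' s + nat_len (nval e s * nval e' s)"

primrec rcost :: "(real \<Rightarrow> nat) \<Rightarrow> rexp \<Rightarrow> state \<Rightarrow> nat" where
  "rcost sz (RNat e) s = ncost e s + sz (real (nval e s))"
| "rcost sz (RGet a e) s = ncost e s + sz (rarr s a (nval e s))"
| "rcost sz (RAdd e e') s = rcost sz e s + rcost sz e' s + sz (rval e s + rval e' s)"
| "rcost sz (RSub e e') s = rcost sz e s + rcost sz e' s + sz (rval e s - rval e' s)"
| "rcost sz (RMul e e') s = rcost sz e s + rcost sz e' s + sz (rval e s * rval e' s)"

primrec bcost :: "(real \<Rightarrow> nat) \<Rightarrow> bexp \<Rightarrow> state \<Rightarrow> nat" where
  "bcost sz (NLess e e') s = ncost e s + ncost e' s + 1"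
| "bcost sz (RLess e e') s = rcost sz e s + rcost sz e' s + 1"
| "bcost sz (BNot b) s = bcost sz b s + 1"
| "bcost sz (BAnd b b') s = bcost sz b s + bcost sz b' s + 1"

definition nupd :: "nat \<Rightarrow> nat \<Rightarrow> nat \<Rightarrow> state \<Rightarrow> state" where
  "nupd a i x s = s\<lparr>narr := (narr s)(a := (narr s a)(i := x))\<rparr>"

definition rupd :: "nat \<Rightarrow> nat \<Rightarrow> real \<Rightarrow> state \<Rightarrow> state" where
  "rupd a i x s = s\<lparr>rarr := (rarr s)(a := (rarr s a)(i := x))\<rparr>"

definition store_vec :: "nat \<Rightarrow> nat \<Rightarrow> (nat \<Rightarrow> real) \<Rightarrow> state \<Rightarrow> state" where
  "store_vec n a f s =
     s\<lparr>rarr := (rarr s)(a := (\<lambda>i. if i \<in> {1..n} then f i else rarr s a i))\<rparr>"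

definition load_vec :: "nat \<Rightarrow> nat \<Rightarrow> state \<Rightarrow> nat \<Rightarrow> real" where
  "load_vec n a s = restrict (rarr s a) {1..n}"

text \<open>
  \<open>exec sz I c s t T\<close>: for instance \<open>I\<close>, program \<open>c\<close> started in \<open>s\<close>
  terminates in \<open>t\<close> at cost \<open>T\<close>. The instance is used by \<open>Query\<close> only. An oracle
  call costs one step, and there is no rule for queries that are not bidding strategies.
\<close>

inductive exec :: "(real \<Rightarrow> nat) \<Rightarrow> wu_instance \<Rightarrow> com \<Rightarrow> state \<Rightarrow> state \<Rightarrow> nat \<Rightarrow> bool"
  for sz :: "real \<Rightarrow> nat" and I :: wu_instance where
  Skip: "exec sz I Skip s s 1"
| NAssign: "exec sz I (NAssign a e e') s (nupd a (nval e s) (nval e' s) s) (ncost e s + ncost e' s + 1)"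
| RAssign: "exec sz I (RAssign a e e') s (rupd a (nval e s) (rval e' s) s) (ncost e s + rcost sz e' s + 1)"
| Seq: "exec sz I c s s' T \<Longrightarrow> exec sz I c' s' s'' T' \<Longrightarrow> exec sz I (Seq c c') s s'' (T + T')"
| IfTrue: "bval b s \<Longrightarrow> exec sz I c s t T \<Longrightarrow> exec sz I (If b c c') s t (bcost sz b s + T)"
| IfFalse: "\<not> bval b s \<Longrightarrow> exec sz I c' s t T \<Longrightarrow> exec sz I (If b c c') s t (bcost sz b s + T)"
| WhileFalse: "\<not> bval b s \<Longrightarrow> exec sz I (While b c) s s (bcost sz b s)"
| WhileTrue: "bval b s \<Longrightarrow> exec sz I c s s' T \<Longrightarrow> exec sz I (While b c) s' s'' T' \<Longrightarrow>
    exec sz I (While b c) s s'' (bcost sz b s + T + T')"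
| Query: "bc = load_vec (n_col I) a s \<Longrightarrow> (\<forall>i\<in>{1..n_col I}. bc i \<in> {0..1}) \<Longrightarrow>
    exec sz I (Query a r p) s
      (store_vec (n_col I) p (exp_payment I bc) (store_vec (n_col I) r (exp_revenue I bc) s)) 1"

inductive_cases exec_SkipE: "exec sz I Skip s t T"
inductive_cases exec_NAssignE: "exec sz I (NAssign a e e') s t T"
inductive_cases exec_RAssignE: "exec sz I (RAssign a e e') s t T"
inductive_cases exec_SeqE: "exec sz I (Seq c c') s t T"
inductive_cases exec_IfE: "exec sz I (If b c c') s t T"
inductive_cases exec_WhileE: "exec sz I (While b c) s t T"
inductive_cases exec_QueryE: "exec sz I (Query a r p) s t T"

lemma exec_deterministic:
  "exec sz I c s t T \<Longrightarrow> exec sz I c s t' T' \<Longrightarrow> t' = t \<and> T' = T"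
proof (induction arbitrary: t' T' rule: exec.induct)
  case Skip
  then show ?case by (rule exec_SkipE) simp
next
  case NAssign
  then show ?case by (rule exec_NAssignE) simp
next
  case RAssign
  then show ?case by (rule exec_RAssignE) simp
next
  case (Seq c s s' T1 c' s'' T2)
  show ?case by (rule exec_SeqE[OF Seq.prems]) (use Seq.IH in blast)
next
  case (IfTrue b s c t T c')
  show ?case by (rule exec_IfE[OF IfTrue.prems]) (use IfTrue.hyps IfTrue.IH in blast)+
next
  case (IfFalse b s c' t T c)
  show ?case by (rule exec_IfE[OF IfFalse.prems]) (use IfFalse.hyps IfFalse.IH in blast)+
next
  case (WhileFalse b s c)
  show ?case by (rule exec_WhileE[OF WhileFalse.prems]) (use WhileFalse.hyps in simp_all)
next
  case (WhileTrue b s c s' T1 s'' T2)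
  show ?case by (rule exec_WhileE[OF WhileTrue.prems]) (use WhileTrue.hyps WhileTrue.IH in blast)+
next
  case (Query bc a s r p)
  show ?case by (rule exec_QueryE[OF Query.prems]) (use Query.hyps in simp)
qed


section \<open>Input, output and running time\<close>

text \<open>
  The distribution of the external bids is not part of the input: a program has access to it
  through the oracle only.
\<close>

definition input_state :: "wu_instance \<Rightarrow> state" where
  "input_state I =
     \<lparr>narr = (\<lambda>_ _. 0)
        (0 := (\<lambda>_. 0)
           (0 := (case mech I of GSP \<Rightarrow> 0 | VCG \<Rightarrow> 1),
            1 := n_col I, 2 := n_ext I, 3 := n_slots I, 4 := n_bids I)),
      rarr = (\<lambda>_ _. 0)
        (0 := (\<lambda>k. if k \<in> {1..n_slots I} then slot_ctr I k else 0),
         1 := (\<lambda>i. if i \<in> {1..n_agents I} then valuation I i else 0),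
         2 := (\<lambda>j. if j \<in> {1..n_bids I} then bid_val I j else 0),
         3 := (\<lambda>i. if i \<in> {1..n_col I} then y_wt I i else 0),
         4 := (\<lambda>_. 0)(0 := x_wt I))\<rparr>"

definition output_strategy :: "wu_instance \<Rightarrow> state \<Rightarrow> nat \<Rightarrow> real" where
  "output_strategy I t = load_vec (n_col I) 5 t"

text \<open>The numerical data consist of the input numbers and the oracle's answers on the bid grid.\<close>

definition input_numbers :: "wu_instance \<Rightarrow> real list" where
  "input_numbers I =
     map (slot_ctr I) [1..<Suc (n_slots I)] @ map (valuation I) [1..<Suc (n_agents I)] @
     map (bid_val I) [1..<Suc (n_bids I)] @ map (y_wt I) [1..<Suc (n_col I)] @ [x_wt I]"

definition oracle_answers :: "wu_instance \<Rightarrow> real set" where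
  "oracle_answers I =
     (\<Union>bc\<in>bid_grid I. exp_revenue I bc ` {1..n_col I} \<union> exp_payment I bc ` {1..n_col I})"

definition rational_instance :: "wu_instance \<Rightarrow> bool" where
  "rational_instance I \<longleftrightarrow> set (input_numbers I) \<subseteq> \<rat> \<and> oracle_answers I \<subseteq> \<rat>"

definition instance_size :: "(real \<Rightarrow> nat) \<Rightarrow> wu_instance \<Rightarrow> nat" where
  "instance_size sz I =
     n_agents I + n_slots I + n_bids I + sum_list (map sz (input_numbers I)) +
     Max (insert 0 (sz ` oracle_answers I))"

definition solves_in_time :: "(real \<Rightarrow> nat) \<Rightarrow> com \<Rightarrow> nat \<Rightarrow> wu_instance \<Rightarrow> bool" where
  "solves_in_time sz c T I \<longleftrightarrow>
     (\<exists>t T'. exec sz I c (input_state I) t T' \<and> T' \<le> T \<and>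
        output_strategy I t \<in> bid_grid I \<and>
        weighted_utility I (output_strategy I t) = Max (weighted_utility I ` bid_grid I))"

end

theory Submission
  imports Defs
begin

text \<open>
  The payments of the colluders taken together depend only on the multiset of their bids, and the
  revenues favour giving the higher slots to the colluders with the larger \<open>y * v\<close>; so some optimal
  strategy \<open>b\<close> is non-increasing in the index of the colluder. For such \<open>b\<close>, the effect of replacing
  the constant tail \<open>b i, b i, \<dots>\<close> after position \<open>i\<close> by \<open>b (i + 1), b (i + 1), \<dots>\<close> does
  not depend on the bids before position \<open>i\<close>: bids above agent \<open>i\<close> do not influence the agents below,
  and a change below \<open>i\<close> shifts the VCG payments of all agents above \<open>i\<close> by the same amount as that of
  \<open>i\<close>, and their GSP payments not at all. With \<open>F i x y\<close> the utility of the strategy with \<open>i\<close> bids \<open>x\<close>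
  followed by bids \<open>y\<close>, the utility of \<open>b\<close> is therefore the constant \<open>F 0 x x\<close>, for an arbitrary
  \<open>x = b 0\<close>, plus the sum of \<open>F i (b i) (b (i + 1)) - F i (b i) (b i)\<close> over \<open>i < n\<^sub>c\<close>. Each term is
  computed from two oracle calls, whatever the mechanism, and dynamic programming over the positions
  and the bid values maximizes the sum.
\<close>

section \<open>Ranks, payments and changes of bids\<close>

text \<open>The oracle reveals expectations only, so the decomposition has to be an identity for
  every fixed external profile, wherever the external bids fall between those of the colluders;
  being linear, it then passes to expectations under any distribution. Its core compares four
  strategies: two that agree up to position \<open>i\<close>, and the same two with the bids before
  \<open>i\<close> lowered to the bid of \<open>i\<close>. Ties broken by index preserve the order
  of the colluders through all these changes. The other obstacle is the logarithmic cost: for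
  rational data a bound on the number of operations is not enough, since lengths might explode under
  repeated multiplication. Here every computed number is a sum of polynomially many products of an
  input number and an oracle answer, so lengths merely add up. All queries lie in the bid grid,
  where the lengths of the answers are part of the instance size. Atomic reals and rationals are
  treated by one argument about an abstract length measure.\<close>

lemma precedes_irrefl_trans:
  shows "\<not> precedes b i i"
    and "precedes b i j \<Longrightarrow> precedes b j k \<Longrightarrow> precedes b i k"
  by (auto simp: precedes_def)

lemma precedes_asym: "precedes b i j \<Longrightarrow> \<not> precedes b j i"
  by (auto simp: precedes_def)

lemma precedes_if_le: "b i \<le> b j \<Longrightarrow> j < i \<Longrightarrow> precedes b j i"
  by (auto simp: precedes_def)

text \<open>In a decreasing list the entries that are at least \<open>t\<close> form a
  prefix.\<close>

lemma nth_ge_iff_less_length_filter: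
  fixes xs :: "'a::linorder list"
  assumes "sorted_wrt (\<ge>) xs" "k < length xs"
  shows "t \<le> xs ! k \<longleftrightarrow> k < length (filter (\<lambda>x. t \<le> x) xs)"
  using assms
proof (induction xs arbitrary: k)
  case (Cons x xs)
  show ?case
  proof (cases "t \<le> x")
    case True
    then show ?thesis using Cons by (cases k) auto
  next
    case False
    have *: "\<forall>y\<in>set xs. y < t" using Cons.prems(1) False by auto
    then have "filter (\<lambda>y. t \<le> y) xs = []" by (auto simp: filter_empty_conv)
    moreover have "(x # xs) ! k < t" using * False Cons.prems(2) by (cases k) auto
    ultimately show ?thesis using False by auto
  qed
qed simp

text \<open>Replaces sorting by counting: bid changes, permutations and measurability are all
  handled through the sets of agents bidding at least \<open>t\<close>.\<close>

lemma le_kth_bid_iff: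
  assumes "k \<in> {1..n_agents I}"
  shows "t \<le> kth_bid I b k \<longleftrightarrow> k \<le> card {j \<in> {1..n_agents I}. t \<le> b j}"
proof -
  define xs where "xs = rev (sort (map b [1..<Suc (n_agents I)]))"
  have "sorted_wrt (\<ge>) xs" unfolding xs_def
    using sorted_sort[of "map b [1..<Suc (n_agents I)]"] by (simp only: sorted_wrt_rev)
  moreover have "k - 1 < length xs" using assms by (auto simp: xs_def)
  ultimately have "t \<le> xs ! (k - 1) \<longleftrightarrow> k - 1 < length (filter (\<lambda>x. t \<le> x) xs)"
    by (rule nth_ge_iff_less_length_filter)
  moreover have "length (filter (\<lambda>x. t \<le> x) xs) = card {j \<in> {1..n_agents I}. t \<le> b j}"
  proof -
    have "mset xs = mset (map b [1..<Suc (n_agents I)])" by (simp add: xs_def)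
    then have "length (filter (\<lambda>x. t \<le> x) xs) = length (filter (\<lambda>x. t \<le> x) (map b [1..<Suc (n_agents I)]))"
      by (metis mset_filter size_mset)
    also have "\<dots> = length (filter (\<lambda>j. t \<le> b j) [1..<Suc (n_agents I)])"
      by (simp add: filter_map o_def del: upt_Suc)
    also have "\<dots> = card {j \<in> {1..n_agents I}. t \<le> b j}"
      by (subst distinct_card[symmetric]) (auto simp del: upt_Suc intro!: arg_cong[where f = card])
    finally show ?thesis .
  qed
  moreover have "kth_bid I b k = xs ! (k - 1)" using assms by (simp add: kth_bid_def xs_def)
  ultimately show ?thesis using assms by auto
qed

text \<open>Agreement at just the two values under comparison suffices, which tolerates bid changes
  that disturb the counts at other thresholds.\<close>

lemma kth_bid_eqI:
  assumes "k \<in> {1..n_agents I}"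
    and "card {j \<in> {1..n_agents I}. kth_bid I b k \<le> b j} = card {j \<in> {1..n_agents I}. kth_bid I b k \<le> b' j}"
    and "card {j \<in> {1..n_agents I}. kth_bid I b' k \<le> b j} = card {j \<in> {1..n_agents I}. kth_bid I b' k \<le> b' j}"
  shows "kth_bid I b k = kth_bid I b' k"
proof (rule order_antisym)
  show "kth_bid I b k \<le> kth_bid I b' k"
    using le_kth_bid_iff[OF assms(1), of "kth_bid I b k" b] le_kth_bid_iff[OF assms(1), of "kth_bid I b k" b']
      assms(2) by simp
  show "kth_bid I b' k \<le> kth_bid I b k"
    using le_kth_bid_iff[OF assms(1), of "kth_bid I b' k" b] le_kth_bid_iff[OF assms(1), of "kth_bid I b' k" b']
      assms(3) by simp
qed

lemma kth_bid_antimono: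
  assumes "1 \<le> k" "k \<le> k'" "k' \<le> n_agents I"
  shows "kth_bid I b k' \<le> kth_bid I b k"
proof -
  have "k' \<le> card {j \<in> {1..n_agents I}. kth_bid I b k' \<le> b j}"
    using le_kth_bid_iff[of k' I "kth_bid I b k'" b] assms by auto
  then show ?thesis using le_kth_bid_iff[of k I "kth_bid I b k'" b] assms by auto
qed

lemma agent_rank_mono:
  assumes "precedes b j i" "j \<in> {1..n_agents I}"
  shows "agent_rank I b j < agent_rank I b i"
proof -
  have "insert j {l \<in> {1..n_agents I}. precedes b l j} \<subseteq> {l \<in> {1..n_agents I}. precedes b l i}"
    using assms by (auto intro: precedes_irrefl_trans(2))
  then have "card (insert j {l \<in> {1..n_agents I}. precedes b l j}) \<le> card {l \<in> {1..n_agents I}. precedes b l i}"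
    by (intro card_mono) auto
  then show ?thesis by (simp add: agent_rank_def precedes_irrefl_trans(1))
qed

lemma agent_rank_range:
  assumes "i \<in> {1..n_agents I}"
  shows "agent_rank I b i \<in> {1..n_agents I}"
proof -
  have "card {l \<in> {1..n_agents I}. precedes b l i} \<le> card ({1..n_agents I} - {i})"
    by (intro card_mono) (auto simp: precedes_irrefl_trans(1))
  then show ?thesis using assms by (simp add: agent_rank_def) linarith
qed

text \<open>The agents ahead of \<open>i\<close>, and \<open>i\<close> itself, bid at least
  \<open>b i\<close>; whoever bids more than \<open>b i\<close> is ahead of \<open>i\<close>. So the
  same thresholds lie below both sides.\<close>

lemma kth_bid_agent_rank:
  assumes i: "i \<in> {1..n_agents I}"
  shows "kth_bid I b (agent_rank I b i) = b i"
proof -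
  let ?P = "{l \<in> {1..n_agents I}. precedes b l i}"
  have "t \<le> kth_bid I b (agent_rank I b i) \<longleftrightarrow> t \<le> b i" for t
  proof (cases "t \<le> b i")
    case True
    have "insert i ?P \<subseteq> {j \<in> {1..n_agents I}. t \<le> b j}"
      using True i by (auto simp: precedes_def)
    then have "card (insert i ?P) \<le> card {j \<in> {1..n_agents I}. t \<le> b j}"
      by (intro card_mono) auto
    then show ?thesis
      using True le_kth_bid_iff[OF agent_rank_range[OF i]] by (simp add: agent_rank_def precedes_irrefl_trans(1))
  next
    case False
    have "{j \<in> {1..n_agents I}. t \<le> b j} \<subseteq> ?P"
      using False i by (auto simp: precedes_def)
    then have "card {j \<in> {1..n_agents I}. t \<le> b j} \<le> card ?P" by (intro card_mono) auto
    then show ?thesis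
      using False le_kth_bid_iff[OF agent_rank_range[OF i]] by (auto simp: agent_rank_def)
  qed
  from this[of "kth_bid I b (agent_rank I b i)"] this[of "b i"] show ?thesis by simp
qed

text \<open>For ranks beyond the last slot the sum is empty, so the case distinction
  disappears.\<close>

lemma vcg_payment_eq:
  "vcg_payment I b i =
     (\<Sum>j = agent_rank I b i + 1..n_slots I + 1. kth_bid I b j * (ctr I (j - 1) - ctr I j))"
  by (auto simp: vcg_payment_def Let_def)

lemma kth_bid_outside: "k \<notin> {1..n_agents I} \<Longrightarrow> kth_bid I b k = 0"
  by (auto simp: kth_bid_def)

section \<open>Changes among the agents ahead of a pivot\<close>

context
  fixes I :: wu_instance and b b' :: "nat \<Rightarrow> real" and i :: nat
  assumes pivot: "i \<in> {1..n_agents I}" "b i = b' i"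
    and change: "\<And>j. j \<in> {1..n_agents I} \<Longrightarrow> b j = b' j \<or> precedes b j i \<and> precedes b' j i"
begin

text \<open>By transitivity a changed agent is ahead of \<open>l\<close> before and after; all
  others compare with \<open>l\<close> as before.\<close>

lemma agent_rank_change_above:
  assumes l: "l \<in> {1..n_agents I}" "l = i \<or> precedes b i l"
  shows "agent_rank I b l = agent_rank I b' l"
proof -
  have bl: "b l = b' l" using change[OF l(1)] l(2) precedes_irrefl_trans(1) precedes_asym by blast
  have "precedes b j l \<longleftrightarrow> precedes b' j l" if "j \<in> {1..n_agents I}" for j
    using change[OF that]
  proof
    assume "b j = b' j"
    then show ?thesis by (simp add: precedes_def bl)
  next
    assume "precedes b j i \<and> precedes b' j i"
    moreover have "precedes b i l \<longleftrightarrow> precedes b' i l" by (simp add: precedes_def bl pivot(2))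
    ultimately show ?thesis using l(2) precedes_irrefl_trans(2) precedes_asym by blast
  qed
  then have "{j \<in> {1..n_agents I}. precedes b j l} = {j \<in> {1..n_agents I}. precedes b' j l}" by blast
  then show ?thesis by (simp add: agent_rank_def)
qed

text \<open>Behind the rank of \<open>i\<close> only bids up to \<open>b i\<close> occur, and for
  thresholds up to \<open>b i\<close> the changed agents are counted in both profiles.\<close>

lemma kth_bid_change_above:
  assumes "agent_rank I b i < k"
  shows "kth_bid I b k = kth_bid I b' k"
proof (cases "k \<in> {1..n_agents I}")
  case True
  have r: "agent_rank I b i = agent_rank I b' i" using agent_rank_change_above[OF pivot(1)] by simp
  have "kth_bid I c k \<le> c i" if "agent_rank I c i < k" for c
    using kth_bid_antimono[of "agent_rank I c i" k I c] kth_bid_agent_rank[OF pivot(1), of c]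
      agent_rank_range[OF pivot(1), of c] that True by simp
  then have le: "kth_bid I b k \<le> b i" "kth_bid I b' k \<le> b' i" using assms r by simp_all
  have "{j \<in> {1..n_agents I}. t \<le> b j} = {j \<in> {1..n_agents I}. t \<le> b' j}" if "t \<le> b i" for t
  proof -
    have "t \<le> b j \<longleftrightarrow> t \<le> b' j" if "j \<in> {1..n_agents I}" for j
      using \<open>t \<le> b i\<close> change[OF that] pivot(2) by (auto simp: precedes_def)
    then show ?thesis by blast
  qed
  from this[OF le(1)] this[of "kth_bid I b' k"] show ?thesis
    using le(2) pivot(2) by (intro kth_bid_eqI True) simp_all
qed (simp add: kth_bid_outside)

lemma revenue_change_above:
  "l \<in> {1..n_agents I} \<Longrightarrow> l = i \<or> precedes b i l \<Longrightarrow> revenue I b l = revenue I b' l"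
  by (simp add: revenue_def agent_rank_change_above)

text \<open>A payment depends on the agent's own rank and on the bids at worse ranks only, and these
  lie behind \<open>i\<close>.\<close>

lemma payment_change_above:
  assumes l: "l \<in> {1..n_agents I}" "l = i \<or> precedes b i l"
  shows "payment I b l = payment I b' l"
proof -
  have "agent_rank I b i \<le> agent_rank I b l"
    using l(2) agent_rank_mono[OF _ pivot(1), of b l] by (auto simp: less_imp_le)
  then have "kth_bid I b k = kth_bid I b' k" if "k > agent_rank I b l" for k
    using that by (intro kth_bid_change_above) simp
  then show ?thesis
    by (cases "mech I")
      (simp_all add: payment_def gsp_payment_def vcg_payment_eq agent_rank_change_above[OF l])
qed

end

section \<open>Changes among the agents behind a pivot\<close>

context
  fixes I :: wu_instance and b b' :: "nat \<Rightarrow> real" and i :: nat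
  assumes pivot: "i \<in> {1..n_agents I}" "b i = b' i"
    and change: "\<And>j. j \<in> {1..n_agents I} \<Longrightarrow> b j = b' j \<or> precedes b i j \<and> precedes b' i j"
begin

lemma agent_rank_change_below:
  assumes l: "l \<in> {1..n_agents I}" "l = i \<or> precedes b l i"
  shows "agent_rank I b l = agent_rank I b' l"
proof -
  have bl: "b l = b' l" using change[OF l(1)] l(2) precedes_irrefl_trans(1) precedes_asym by blast
  have "precedes b j l \<longleftrightarrow> precedes b' j l" if "j \<in> {1..n_agents I}" for j
    using change[OF that]
  proof
    assume "b j = b' j"
    then show ?thesis by (simp add: precedes_def bl)
  next
    assume "precedes b i j \<and> precedes b' i j"
    moreover have "precedes b l i \<longleftrightarrow> precedes b' l i" by (simp add: precedes_def bl pivot(2))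
    ultimately show ?thesis using l(2) precedes_irrefl_trans(2) precedes_asym by blast
  qed
  then have "{j \<in> {1..n_agents I}. precedes b j l} = {j \<in> {1..n_agents I}. precedes b' j l}" by blast
  then show ?thesis by (simp add: agent_rank_def)
qed

lemma kth_bid_change_below:
  assumes "1 \<le> k" "k \<le> agent_rank I b i"
  shows "kth_bid I b k = kth_bid I b' k"
proof -
  have r: "agent_rank I b i = agent_rank I b' i" using agent_rank_change_below[OF pivot(1)] by simp
  have k: "k \<in> {1..n_agents I}" using agent_rank_range[OF pivot(1), of b] assms by auto
  have *: "c i \<le> kth_bid I c k" if "k \<le> agent_rank I c i" for c
    using kth_bid_antimono[of k "agent_rank I c i" I c] kth_bid_agent_rank[OF pivot(1), of c]
      agent_rank_range[OF pivot(1), of c] that assms(1) by simp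
  have ge: "b i \<le> kth_bid I b k" "b i \<le> kth_bid I b' k"
    using *[of b] *[of b'] assms r pivot(2) by simp_all
  \<comment> \<open>A changed agent may tie with \<open>i\<close>, so only thresholds strictly above
    \<open>b i\<close> are sure to keep their counts. As both bids are at least \<open>b i\<close>,
    these thresholds decide the equality.\<close>
  have *: "t \<le> kth_bid I b k \<longleftrightarrow> t \<le> kth_bid I b' k" if "b i < t" for t
  proof -
    have "t \<le> b j \<longleftrightarrow> t \<le> b' j" if "j \<in> {1..n_agents I}" for j
      using \<open>b i < t\<close> change[OF that] pivot(2) by (auto simp: precedes_def)
    then have "{j \<in> {1..n_agents I}. t \<le> b j} = {j \<in> {1..n_agents I}. t \<le> b' j}" by blast
    then show ?thesis by (simp add: le_kth_bid_iff[OF k])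
  qed
  from *[of "kth_bid I b k"] *[of "kth_bid I b' k"] show ?thesis using ge by linarith
qed

lemma revenue_change_below:
  "l \<in> {1..n_agents I} \<Longrightarrow> l = i \<or> precedes b l i \<Longrightarrow> revenue I b l = revenue I b' l"
  by (simp add: revenue_def agent_rank_change_below)

text \<open>GSP charges the next bid, whose rank is at most that of \<open>i\<close>. A VCG payment
  is a tail sum over ranks: the portion up to the rank of \<open>i\<close> is unchanged, and the
  remainder is the payment of \<open>i\<close>.\<close>

lemma payment_change_below:
  assumes l: "l \<in> {1..n_agents I}" "precedes b l i"
  shows "payment I b l - payment I b' l =
    (case mech I of GSP \<Rightarrow> 0 | VCG \<Rightarrow> payment I b i - payment I b' i)"
proof -
  have lt: "agent_rank I b l < agent_rank I b i" using agent_rank_mono l by blast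
  have r: "agent_rank I b' l = agent_rank I b l" "agent_rank I b' i = agent_rank I b i"
    using agent_rank_change_below l pivot(1) by simp_all
  show ?thesis
  proof (cases "mech I")
    case GSP
    then show ?thesis
      using lt by (simp add: payment_def gsp_payment_def r kth_bid_change_below)
  next
    case VCG
    \<comment> \<open>Cutting by an intersection also covers a rank of \<open>i\<close> beyond the
      last slot, where \<open>i\<close> pays 0.\<close>
    let ?A = "{agent_rank I b l + 1..n_slots I + 1} \<inter> {..agent_rank I b i}"
    have split: "vcg_payment I c l =
        (\<Sum>j\<in>?A. kth_bid I c j * (ctr I (j - 1) - ctr I j)) + vcg_payment I c i"
      if "agent_rank I c l = agent_rank I b l" "agent_rank I c i = agent_rank I b i" for c
      unfolding vcg_payment_eq that
    proof -
      have "{agent_rank I b l + 1..n_slots I + 1} = ?A \<union> {agent_rank I b i + 1..n_slots I + 1}"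
        using lt by auto
      moreover have "?A \<inter> {agent_rank I b i + 1..n_slots I + 1} = {}" by auto
      ultimately show "sum g {agent_rank I b l + 1..n_slots I + 1} =
          sum g ?A + sum g {agent_rank I b i + 1..n_slots I + 1}" for g :: "nat \<Rightarrow> real"
        by (metis finite_Int finite_atLeastAtMost sum.union_disjoint)
    qed
    have "(\<Sum>j\<in>?A. kth_bid I b j * (ctr I (j - 1) - ctr I j)) =
        (\<Sum>j\<in>?A. kth_bid I b' j * (ctr I (j - 1) - ctr I j))"
      by (intro sum.cong) (auto simp: kth_bid_change_below)
    then show ?thesis using VCG split[of b] split[of b'] r by (simp add: payment_def)
  qed
qed

end

section \<open>Utility for a fixed external profile\<close>

definition utility :: "wu_instance \<Rightarrow> (nat \<Rightarrow> real) \<Rightarrow> real" where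
  "utility I b = (\<Sum>i = 1..n_col I. y_wt I i * revenue I b i - x_wt I * payment I b i)"

text \<open>Flattening the prefix (\<open>p\<close> to \<open>p'\<close>) does not reach the agents
  from \<open>i\<close> on. Replacing the tail (\<open>p\<close> to \<open>q\<close>) affects an
  earlier agent only by a payment shift, which is that of \<open>i\<close> or 0, and the shift of
  \<open>i\<close> is not affected by flattening.\<close>

lemma utility_exchange:
  assumes i: "i \<in> {1..n_col I}"
    and mono: "antimono_on {1..n_col I} p" "antimono_on {1..n_col I} q"
    and prefix: "\<And>l. l \<in> {1..i} \<Longrightarrow> p l = q l"
    and p': "\<And>l. l \<in> {1..n_col I} \<Longrightarrow> p' l = (if l \<le> i then p i else p l)"
    and q': "\<And>l. l \<in> {1..n_col I} \<Longrightarrow> q' l = (if l \<le> i then q i else q l)"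
  shows "utility I (profile I p be) - utility I (profile I q be) =
    utility I (profile I p' be) - utility I (profile I q' be)"
proof -
  let ?N = "{1..n_agents I}"
  let ?f = "\<lambda>c. profile I c be"
  have N: "{1..n_col I} \<subseteq> ?N" by (auto simp: n_agents_def)
  then have iN: "i \<in> ?N" using i by blast
  have dec: "c l' \<le> c l"
    if "antimono_on {1..n_col I} c" "1 \<le> l" "l \<le> l'" "l' \<le> n_col I" for l l' and c :: "nat \<Rightarrow> real"
    using that by (auto simp: monotone_on_def)
  have col: "?f c j = c j" if "j \<le> n_col I" for c j using that by (simp add: profile_def)
  have above_i: "?f c i = ?f c' i"
    and above: "?f c j = ?f c' j \<or> precedes (?f c) j i \<and> precedes (?f c') j i"
    if c: "antimono_on {1..n_col I} c" "\<And>l. l \<in> {1..n_col I} \<Longrightarrow> c' l = (if l \<le> i then c i else c l)"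
      and j: "j \<in> ?N" for c c' j
  proof -
    show "?f c i = ?f c' i" using c(2)[OF i] i by (simp add: col)
    show "?f c j = ?f c' j \<or> precedes (?f c) j i \<and> precedes (?f c') j i"
    proof (cases "j < i")
      case True
      \<comment> \<open>After flattening, the earlier colluders tie with \<open>i\<close> and stay
        ahead of it by the tie-break.\<close>
      have "c i \<le> c j" "c' i \<le> c' j" using dec[OF c(1), of j i] c(2)[OF i] c(2)[of j] True i j by auto
      then show ?thesis using True i by (auto simp: col intro!: precedes_if_le)
    next
      case False
      then show ?thesis using c(2)[of j] j by (auto simp: profile_def)
    qed
  qed
  have mono': "antimono_on {1..n_col I} p'" "antimono_on {1..n_col I} q'"
    using p' q' dec[OF mono(1)] dec[OF mono(2)] i by (auto simp: monotone_on_def)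
  have below_i: "?f c i = ?f c' i"
    and below: "?f c j = ?f c' j \<or> precedes (?f c) i j \<and> precedes (?f c') i j"
    if c: "antimono_on {1..n_col I} c" "antimono_on {1..n_col I} c'" "\<And>l. l \<in> {1..i} \<Longrightarrow> c l = c' l"
      and j: "j \<in> ?N" for c c' j
  proof -
    show "?f c i = ?f c' i" using c(3)[of i] i by (simp add: col)
    show "?f c j = ?f c' j \<or> precedes (?f c) i j \<and> precedes (?f c') i j"
    proof (cases "i < j \<and> j \<le> n_col I")
      case True
      have "c j \<le> c i" "c' j \<le> c' i" using dec[OF c(1), of i j] dec[OF c(2), of i j] True i by auto
      then show ?thesis using True i by (auto simp: col intro!: precedes_if_le)
    next
      case False
      then show ?thesis using c(3)[of j] j by (auto simp: profile_def)
    qed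
  qed
  have prefix': "p' l = q' l" if "l \<in> {1..i}" for l
    using that p'[of l] q'[of l] prefix[of i] i by auto
  have pre: "l = i \<or> precedes (?f c) i l"
    if "antimono_on {1..n_col I} c" "l \<in> {1..n_col I}" "i \<le> l" for c l
    using that i dec[of c i l] by (cases "l = i") (auto simp: col intro!: precedes_if_le)
  have post: "precedes (?f c) l i"
    if "antimono_on {1..n_col I} c" "l \<in> {1..n_col I}" "l < i" for c l
    using that i dec[of c l i] by (auto simp: col intro!: precedes_if_le)
  note above_p = above_i[OF mono(1) p' iN] above[OF mono(1) p']
  note above_q = above_i[OF mono(2) q' iN] above[OF mono(2) q']
  note below_pq = below_i[OF mono prefix iN] below[OF mono prefix]
  note below_pq' = below_i[OF mono' prefix' iN] below[OF mono' prefix']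
  let ?u = "\<lambda>c l. y_wt I l * revenue I (?f c) l - x_wt I * payment I (?f c) l"
  have "?u p l - ?u q l = ?u p' l - ?u q' l" if l: "l \<in> {1..n_col I}" for l
  proof -
    have lN: "l \<in> ?N" using l N by blast
    show ?thesis
    proof (cases "i \<le> l")
      case True
      note pr = pre[OF mono(1) l True] pre[OF mono(2) l True]
      have "revenue I (?f p) l = revenue I (?f p') l" "revenue I (?f q) l = revenue I (?f q') l"
        using revenue_change_above[OF iN above_p lN pr(1)] revenue_change_above[OF iN above_q lN pr(2)]
        by blast+
      moreover have "payment I (?f p) l = payment I (?f p') l" "payment I (?f q) l = payment I (?f q') l"
        using payment_change_above[OF iN above_p lN pr(1)] payment_change_above[OF iN above_q lN pr(2)]
        by blast+
      ultimately show ?thesis by simp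
    next
      case False
      then have "l < i" by simp
      note pr = post[OF mono(1) l this] post[OF mono'(1) l this]
      have "revenue I (?f p) l = revenue I (?f q) l" "revenue I (?f p') l = revenue I (?f q') l"
        using revenue_change_below[OF iN below_pq lN disjI2[OF pr(1)]]
          revenue_change_below[OF iN below_pq' lN disjI2[OF pr(2)]]
        by blast+
      moreover have "payment I (?f p) i = payment I (?f p') i" "payment I (?f q) i = payment I (?f q') i"
        using payment_change_above[OF iN above_p iN disjI1] payment_change_above[OF iN above_q iN disjI1]
        by blast+
      \<comment> \<open>Each side is the payment change of \<open>i\<close> for VCG and 0 for GSP,
        and that change is the same with and without flattening.\<close>
      then have "payment I (?f p) l - payment I (?f q) l = payment I (?f p') l - payment I (?f q') l"
        using payment_change_below[OF iN below_pq lN pr(1)] payment_change_below[OF iN below_pq' lN pr(2)]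
        by (cases "mech I") simp_all
      then have "x_wt I * payment I (?f p) l - x_wt I * payment I (?f q) l =
          x_wt I * payment I (?f p') l - x_wt I * payment I (?f q') l"
        by (metis right_diff_distrib)
      ultimately show ?thesis by simp
    qed
  qed
  then show ?thesis unfolding utility_def by (simp add: sum_subtractf[symmetric])
qed

text \<open>The swap leaves the total payment unchanged and gives the better rank to the colluder
  whose weighted value is at least as large.\<close>

lemma utility_transpose:
  assumes valid: "valid_instance I" and i: "1 \<le> i" "Suc i \<le> n_col I" and less: "b i < b (Suc i)"
  shows "utility I (profile I b be) \<le> utility I (profile I (b \<circ> Transposition.transpose i (Suc i)) be)"
proof -
  define t where "t = Transposition.transpose i (Suc i)"
  let ?f = "profile I b be"
  have prof: "profile I (b \<circ> t) be = ?f \<circ> t"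
    using i by (auto simp: fun_eq_iff profile_def t_def Transposition.transpose_def)
  \<comment> \<open>The bids of \<open>i\<close> and \<open>Suc i\<close> differ, so no tie between
    them is reversed; any other agent number is smaller than both or larger than both.\<close>
  have prec: "precedes (?f \<circ> t) j l \<longleftrightarrow> precedes ?f (t j) (t l)" for j l
    using i less by (auto simp: precedes_def profile_def t_def Transposition.transpose_def)
  have bij: "bij_betw t {j \<in> {1..n_agents I}. P (t j)} {j \<in> {1..n_agents I}. P j}" for P
    by (rule bij_betwI[where g = t]) (use i in \<open>auto simp: t_def Transposition.transpose_def n_agents_def\<close>)
  have rank: "agent_rank I (?f \<circ> t) l = agent_rank I ?f (t l)" for l
    unfolding agent_rank_def prec using bij_betw_same_card[OF bij] by simp
  have "card {j \<in> {1..n_agents I}. x \<le> (?f \<circ> t) j} = card {j \<in> {1..n_agents I}. x \<le> ?f j}" for x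
    using bij_betw_same_card[OF bij[of "\<lambda>j. x \<le> ?f j"]] by simp
  then have kth: "kth_bid I (?f \<circ> t) k = kth_bid I ?f k" for k
    by (cases "k \<in> {1..n_agents I}") (auto intro: kth_bid_eqI simp: kth_bid_outside)
  have pay: "payment I (?f \<circ> t) l = payment I ?f (t l)" for l
    by (cases "mech I") (simp_all only: payment_def gsp_payment_def vcg_payment_eq rank kth mechanism.case)
  have bijc: "bij_betw t {1..n_col I} {1..n_col I}"
    by (rule bij_betwI[where g = t]) (use i in \<open>auto simp: t_def Transposition.transpose_def\<close>)
  have sum_pay: "(\<Sum>l = 1..n_col I. payment I (?f \<circ> t) l) = (\<Sum>l = 1..n_col I. payment I ?f l)"
    unfolding pay by (rule sum.reindex_bij_betw[OF bijc])
  define w where "w l = y_wt I l * valuation I l" for l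
  define \<Lambda> where "\<Lambda> l = ctr I (agent_rank I ?f l)" for l
  have w: "w (Suc i) \<le> w i"
    using valid i by (auto simp: valid_instance_def w_def monotone_on_def)
  have iN: "i \<in> {1..n_agents I}" "Suc i \<in> {1..n_agents I}" using i by (auto simp: n_agents_def)
  have "precedes ?f (Suc i) i" using less i by (auto simp: precedes_def profile_def)
  then have "agent_rank I ?f (Suc i) < agent_rank I ?f i" using agent_rank_mono iN by blast
  \<comment> \<open>Past the last slot the rate drops to 0, so the rates must be nonnegative as well
    as decreasing.\<close>
  moreover have "ctr I k' \<le> ctr I k" if "1 \<le> k" "k \<le> k'" for k k'
  proof -
    have "0 \<le> slot_ctr I k" if "k \<le> n_slots I"
      using valid that \<open>1 \<le> k\<close> by (auto simp: valid_instance_def image_subset_iff)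
    moreover have "slot_ctr I k' \<le> slot_ctr I k" if "k' \<le> n_slots I"
      using valid that \<open>1 \<le> k\<close> \<open>k \<le> k'\<close> by (auto simp: valid_instance_def monotone_on_def)
    ultimately show ?thesis using that by (auto simp: ctr_def)
  qed
  ultimately have \<Lambda>: "\<Lambda> i \<le> \<Lambda> (Suc i)"
    using agent_rank_range[OF iN(2), of ?f] by (auto simp: \<Lambda>_def)
  have split: "(\<Sum>l = 1..n_col I. g l) = g i + g (Suc i) + (\<Sum>l\<in>{1..n_col I} - {i, Suc i}. g l)"
    for g :: "nat \<Rightarrow> real"
    using i by (subst sum.subset_diff[of "{i, Suc i}"]) auto
  have "(\<Sum>l = 1..n_col I. w l * \<Lambda> l) \<le> (\<Sum>l = 1..n_col I. w l * \<Lambda> (t l))"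
  proof -
    have "(\<Sum>l\<in>{1..n_col I} - {i, Suc i}. w l * \<Lambda> (t l)) = (\<Sum>l\<in>{1..n_col I} - {i, Suc i}. w l * \<Lambda> l)"
      by (intro sum.cong) (auto simp: t_def Transposition.transpose_def)
    \<comment> \<open>The rearrangement inequality for two terms.\<close>
    moreover have "0 \<le> (w i - w (Suc i)) * (\<Lambda> (Suc i) - \<Lambda> i)" "t i = Suc i" "t (Suc i) = i"
      using w \<Lambda> by (simp_all add: t_def)
    ultimately show ?thesis by (subst (1 2) split) (simp add: algebra_simps)
  qed
  then show ?thesis
    using sum_pay
    unfolding t_def[symmetric] prof
    by (simp add: utility_def sum_subtractf revenue_def rank w_def \<Lambda>_def ac_simps
        flip: sum_distrib_left)
qed

section \<open>Expected utility\<close>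

lemma valid_prob_space: "valid_instance I \<Longrightarrow> prob_space (ext_dist I)"
  by (simp add: valid_instance_def)

section \<open>Measurability of ranks, bids and payments\<close>

lemma profile_measurable:
  assumes "valid_instance I" "j \<in> {1..n_agents I}"
  shows "(\<lambda>be. profile I bc be j) \<in> borel_measurable (ext_dist I)"
proof (cases "j \<le> n_col I")
  case False
  have sets: "sets (ext_dist I) = sets (Pi\<^sub>M {1..n_ext I} (\<lambda>_. borel))"
    using assms(1) by (simp add: valid_instance_def)
  have "(\<lambda>be. be (j - n_col I)) \<in> borel_measurable (Pi\<^sub>M {1..n_ext I} (\<lambda>_. borel :: real measure))"
    using assms(2) False by (intro measurable_component_singleton) (auto simp: n_agents_def)
  then show ?thesis
    using False by (simp add: profile_def measurable_cong_sets[OF sets])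
qed (simp add: profile_def)

lemma precedes_measurable:
  assumes "valid_instance I" "j \<in> {1..n_agents I}" "i \<in> {1..n_agents I}"
  shows "Measurable.pred (ext_dist I) (\<lambda>be. precedes (profile I bc be) j i)"
proof -
  note [measurable] = profile_measurable[OF assms(1,2), of bc] profile_measurable[OF assms(1,3), of bc]
  have eq: "precedes b j i \<longleftrightarrow> b i < b j \<or> (\<not> b j < b i \<and> j < i)" for b :: "nat \<Rightarrow> real"
    by (auto simp: precedes_def)
  show ?thesis unfolding eq by measurable
qed

lemma card_measurable:
  fixes A :: "nat set"
  assumes "\<And>j. j \<in> A \<Longrightarrow> Measurable.pred M (P j)"
  shows "(\<lambda>x. card {j \<in> A. P j x}) \<in> measurable M (count_space UNIV)"
proof -
  have "Measurable.pred M (\<lambda>x. j \<in> A \<and> P j x)" for j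
    using assms[of j] by (cases "j \<in> A") auto
  then show ?thesis by (intro measurable_card) (simp add: pred_def)
qed

lemma agent_rank_measurable:
  assumes "valid_instance I" "i \<in> {1..n_agents I}"
  shows "(\<lambda>be. agent_rank I (profile I bc be) i) \<in> measurable (ext_dist I) (count_space UNIV)"
proof -
  have [measurable]: "(\<lambda>be. card {j \<in> {1..n_agents I}. precedes (profile I bc be) j i})
      \<in> measurable (ext_dist I) (count_space UNIV)"
    by (rule card_measurable) (rule precedes_measurable[OF assms(1) _ assms(2)])
  show ?thesis unfolding agent_rank_def by measurable
qed

text \<open>The superlevel sets of the \<open>k\<close>-th bid are counting events.\<close>

lemma kth_bid_measurable:
  assumes "valid_instance I"
  shows "(\<lambda>be. kth_bid I (profile I bc be) k) \<in> borel_measurable (ext_dist I)"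
proof (cases "k \<in> {1..n_agents I}")
  case True
  have "Measurable.pred (ext_dist I) (\<lambda>be. t \<le> kth_bid I (profile I bc be) k)" for t
  proof -
    have "Measurable.pred (ext_dist I) (\<lambda>be. t \<le> profile I bc be j)" if "j \<in> {1..n_agents I}" for j
      unfolding pred_def by (rule borel_measurable_le[OF borel_measurable_const profile_measurable[OF assms that]])
    then have [measurable]: "(\<lambda>be. card {j \<in> {1..n_agents I}. t \<le> profile I bc be j})
        \<in> measurable (ext_dist I) (count_space UNIV)"
      by (rule card_measurable)
    show ?thesis unfolding le_kth_bid_iff[OF True] by measurable
  qed
  then show ?thesis by (auto simp: borel_measurable_iff_ge pred_def)
qed (simp add: kth_bid_outside)

lemma revenue_measurable:
  assumes "valid_instance I" "i \<in> {1..n_agents I}"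
  shows "(\<lambda>be. revenue I (profile I bc be) i) \<in> borel_measurable (ext_dist I)"
proof -
  note [measurable] = agent_rank_measurable[OF assms, of bc]
  show ?thesis unfolding revenue_def by measurable
qed

text \<open>The rank makes the bid index and the summation range random; it takes countably many
  values, so measurability may be checked for each fixed rank.\<close>

lemma payment_measurable:
  assumes "valid_instance I" "i \<in> {1..n_agents I}"
  shows "(\<lambda>be. payment I (profile I bc be) i) \<in> borel_measurable (ext_dist I)"
proof -
  note [measurable] = agent_rank_measurable[OF assms, of bc] kth_bid_measurable[OF assms(1), of bc]
  have 1: "(\<lambda>be. gsp_payment I (profile I bc be) i) \<in> borel_measurable (ext_dist I)"
    unfolding gsp_payment_def
    by (rule measurable_compose_countable[OF _ agent_rank_measurable[OF assms]]) measurable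
  have 2: "(\<lambda>be. vcg_payment I (profile I bc be) i) \<in> borel_measurable (ext_dist I)"
    unfolding vcg_payment_eq
    by (rule measurable_compose_countable[OF _ agent_rank_measurable[OF assms]]) measurable
  show ?thesis using 1 2 by (cases "mech I") (simp_all add: payment_def)
qed

section \<open>Bounds and integrability\<close>

lemma ctr_range:
  assumes "valid_instance I" "1 \<le> k"
  shows "ctr I k \<in> {0..1}"
  using assms by (auto simp: ctr_def valid_instance_def image_subset_iff)

lemma kth_bid_range:
  assumes "\<And>j. j \<in> {1..n_agents I} \<Longrightarrow> b j \<in> {0..1}"
  shows "kth_bid I b k \<in> {0..1}"
proof (cases "k \<in> {1..n_agents I}")
  case True
  have "{j \<in> {1..n_agents I}. 0 \<le> b j} = {1..n_agents I}" using assms by auto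
  then have "0 \<le> kth_bid I b k" using True by (simp add: le_kth_bid_iff[OF True])
  moreover have "kth_bid I b k \<le> 1"
  proof (rule ccontr)
    assume gt: "\<not> kth_bid I b k \<le> 1"
    have "k \<le> card {j \<in> {1..n_agents I}. kth_bid I b k \<le> b j}"
      using le_kth_bid_iff[OF True, of "kth_bid I b k" b] by simp
    moreover have "{j \<in> {1..n_agents I}. kth_bid I b k \<le> b j} = {}"
      using assms gt by fastforce
    ultimately show False using True by (metis atLeastAtMost_iff card.empty not_one_le_zero order_trans)
  qed
  ultimately show ?thesis by simp
qed (simp add: kth_bid_outside)

lemma AE_profile_range:
  assumes "valid_instance I" and "\<And>j. j \<in> {1..n_col I} \<Longrightarrow> bc j \<in> {0..1}"
  shows "AE be in ext_dist I. \<forall>j\<in>{1..n_agents I}. profile I bc be j \<in> {0..1}"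
proof -
  have "AE be in ext_dist I. \<forall>j\<in>{1..n_ext I}. be j \<in> {0..1}"
    using assms(1) by (simp add: valid_instance_def)
  then show ?thesis
  proof eventually_elim
    case (elim be)
    show ?case
    proof
      fix j assume j: "j \<in> {1..n_agents I}"
      show "profile I bc be j \<in> {0..1}"
      proof (cases "j \<le> n_col I")
        case False
        then have "j - n_col I \<in> {1..n_ext I}" using j by (auto simp: n_agents_def)
        then show ?thesis using elim False by (simp add: profile_def)
      qed (use assms(2)[of j] j in \<open>simp add: profile_def\<close>)
    qed
  qed
qed

lemma revenue_integrable:
  assumes "valid_instance I" "i \<in> {1..n_agents I}"
  shows "integrable (ext_dist I) (\<lambda>be. revenue I (profile I bc be) i)"
proof -
  interpret prob_space "ext_dist I" using valid_prob_space assms by blast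
  have "\<bar>revenue I b i\<bar> \<le> \<bar>valuation I i\<bar>" for b
    using ctr_range[OF assms(1), of "agent_rank I b i"] agent_rank_range[OF assms(2), of b]
    by (auto simp: revenue_def abs_mult intro!: mult_left_le_one_le)
  then show ?thesis
    by (intro integrable_const_bound[where B = "\<bar>valuation I i\<bar>"] revenue_measurable assms) auto
qed

lemma payment_integrable:
  assumes "valid_instance I" "i \<in> {1..n_agents I}" and "\<And>j. j \<in> {1..n_col I} \<Longrightarrow> bc j \<in> {0..1}"
  shows "integrable (ext_dist I) (\<lambda>be. payment I (profile I bc be) i)"
proof -
  interpret prob_space "ext_dist I" using valid_prob_space assms by blast
  have prod: "\<bar>x * y\<bar> \<le> 1" if "x \<in> {0..1}" "y \<in> {0..1}" for x y :: real
    using that by (auto simp: abs_mult intro: mult_le_one)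
  have "AE be in ext_dist I. \<forall>j\<in>{1..n_agents I}. profile I bc be j \<in> {0..1}"
    by (rule AE_profile_range[OF assms(1,3)])
  \<comment> \<open>The VCG sum has at most \<open>n_slots I\<close> terms, each at most 1 in
    absolute value; the extra 1 covers the GSP payment.\<close>
  then have "AE be in ext_dist I. \<bar>payment I (profile I bc be) i\<bar> \<le> 1 + real (n_slots I)"
  proof eventually_elim
    case (elim be)
    let ?b = "profile I bc be"
    let ?k = "agent_rank I ?b i"
    have k: "1 \<le> ?k" using agent_rank_range[OF assms(2), of ?b] by simp
    have kth: "kth_bid I ?b k \<in> {0..1}" for k using elim by (intro kth_bid_range) blast
    have "\<bar>gsp_payment I ?b i\<bar> \<le> 1"
      unfolding gsp_payment_def by (intro prod kth ctr_range[OF assms(1) k])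
    moreover have "\<bar>vcg_payment I ?b i\<bar> \<le> (\<Sum>j = ?k + 1..n_slots I + 1. 1)"
      unfolding vcg_payment_eq
    proof (rule order_trans[OF sum_abs], rule sum_mono)
      fix j assume j: "j \<in> {?k + 1..n_slots I + 1}"
      have "\<bar>ctr I (j - 1) - ctr I j\<bar> \<le> 1"
      proof -
        have "1 \<le> j - 1" "1 \<le> j" using j k by auto
        from this[THEN ctr_range[OF assms(1)]] show ?thesis by auto
      qed
      then show "\<bar>kth_bid I ?b j * (ctr I (j - 1) - ctr I j)\<bar> \<le> 1"
        using kth[of j] by (auto simp: abs_mult intro: mult_le_one)
    qed
    moreover have "(\<Sum>j = ?k + 1..n_slots I + 1. 1 :: real) \<le> 1 + real (n_slots I)" by simp
    ultimately show ?case by (cases "mech I") (auto simp: payment_def)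
  qed
  then show ?thesis
    by (intro integrable_const_bound[where B = "1 + real (n_slots I)"] payment_measurable assms) auto
qed

lemma utility_integrable:
  assumes "valid_instance I" and "\<And>j. j \<in> {1..n_col I} \<Longrightarrow> bc j \<in> {0..1}"
  shows "integrable (ext_dist I) (\<lambda>be. utility I (profile I bc be))"
  unfolding utility_def
  by (intro Bochner_Integration.integrable_sum Bochner_Integration.integrable_diff
      integrable_mult_right revenue_integrable payment_integrable assms) (auto simp: n_agents_def)

text \<open>Carries inequalities and identities for a fixed external profile over to the
  expectation.\<close>

lemma weighted_utility_eq:
  assumes "valid_instance I" and "\<And>j. j \<in> {1..n_col I} \<Longrightarrow> bc j \<in> {0..1}"
  shows "weighted_utility I bc = (\<integral>be. utility I (profile I bc be) \<partial>ext_dist I)"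
proof -
  have N: "i \<in> {1..n_agents I}" if "i \<in> {1..n_col I}" for i using that by (auto simp: n_agents_def)
  note int = revenue_integrable[OF assms(1) N, of _ bc] payment_integrable[OF assms(1) N assms(2)]
  show ?thesis
    unfolding utility_def weighted_utility_def exp_revenue_def exp_payment_def
    using int by (simp add: Bochner_Integration.integral_sum)
qed

section \<open>Sorted strategies as paths\<close>

lemma bid_grid_range:
  assumes "valid_instance I" "b \<in> bid_grid I" "i \<in> {1..n_col I}"
  shows "b i \<in> {0..1}"
proof -
  have "b i \<in> bid_val I ` {1..n_bids I}" using assms(2,3) unfolding bid_grid_def by (rule PiE_mem)
  moreover have "bid_val I ` {1..n_bids I} \<subseteq> {0..1}" using assms(1) by (simp add: valid_instance_def)
  ultimately show ?thesis by blast
qed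

lemma finite_bid_grid: "finite (bid_grid I)"
  unfolding bid_grid_def by (intro finite_PiE) auto

lemma bid_grid_nonempty: "valid_instance I \<Longrightarrow> bid_grid I \<noteq> {}"
  by (auto simp: bid_grid_def PiE_eq_empty_iff valid_instance_def)

lemma weighted_utility_grid:
  assumes "valid_instance I" "b \<in> bid_grid I"
  shows "weighted_utility I b = (\<integral>be. utility I (profile I b be) \<partial>ext_dist I)"
    and "integrable (ext_dist I) (\<lambda>be. utility I (profile I b be))"
proof -
  have *: "b j \<in> {0..1}" if "j \<in> {1..n_col I}" for j using assms that by (rule bid_grid_range)
  show "weighted_utility I b = (\<integral>be. utility I (profile I b be) \<partial>ext_dist I)"
    and "integrable (ext_dist I) (\<lambda>be. utility I (profile I b be))"
    by (rule weighted_utility_eq[OF assms(1) *] utility_integrable[OF assms(1) *]; assumption)+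
qed

lemma bid_val_antimono:
  assumes "valid_instance I" "j \<in> {1..n_bids I}" "k \<in> {1..n_bids I}" "j \<le> k"
  shows "bid_val I k \<le> bid_val I j"
proof -
  have "antimono_on {1..n_bids I} (bid_val I)" using assms(1) by (simp add: valid_instance_def)
  from monotone_onD[OF this assms(2-4)] show ?thesis .
qed

lemma weighted_utility_transpose:
  assumes valid: "valid_instance I" and b: "b \<in> bid_grid I"
    and i: "1 \<le> i" "Suc i \<le> n_col I" and less: "b i < b (Suc i)"
  defines "b' \<equiv> b \<circ> Transposition.transpose i (Suc i)"
  shows "b' \<in> bid_grid I" "weighted_utility I b \<le> weighted_utility I b'"
proof -
  show b': "b' \<in> bid_grid I"
    using b i unfolding bid_grid_def b'_def
    by (auto simp: PiE_iff extensional_def Transposition.transpose_def)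
  show "weighted_utility I b \<le> weighted_utility I b'"
    unfolding weighted_utility_grid(1)[OF valid b] weighted_utility_grid(1)[OF valid b']
    by (intro integral_mono weighted_utility_grid(2)[OF valid b] weighted_utility_grid(2)[OF valid b'])
      (simp add: b'_def utility_transpose[OF valid i less])
qed

text \<open>
  Among the optimal strategies, one that maximizes \<open>\<Sum>i. (n\<^sub>c - i) * b i\<close> is sorted, since swapping
  adjacent bids in the wrong order increases this sum.
\<close>

lemma exists_sorted_optimum:
  assumes valid: "valid_instance I"
  obtains b where "b \<in> bid_grid I" "antimono_on {1..n_col I} b"
    "weighted_utility I b = Max (weighted_utility I ` bid_grid I)"
proof -
  let ?n = "n_col I"
  let ?M = "Max (weighted_utility I ` bid_grid I)"
  define S where "S = {b \<in> bid_grid I. weighted_utility I b = ?M}"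
  define \<phi> where "\<phi> b = (\<Sum>i = 1..?n. (real ?n - real i) * b i)" for b :: "nat \<Rightarrow> real"
  have "?M \<in> weighted_utility I ` bid_grid I"
    using finite_bid_grid bid_grid_nonempty[OF valid] by (intro Max_in) auto
  then have "S \<noteq> {}" by (auto simp: S_def)
  moreover have finS: "finite S" using finite_bid_grid by (simp add: S_def)
  ultimately have "Max (\<phi> ` S) \<in> \<phi> ` S" by (intro Max_in) auto
  then obtain b where b: "b \<in> S" "\<phi> b = Max (\<phi> ` S)" by auto
  have step: "b (Suc i) \<le> b i" if i: "1 \<le> i" "Suc i \<le> ?n" for i
  proof (rule ccontr)
    assume "\<not> b (Suc i) \<le> b i"
    then have less: "b i < b (Suc i)" by simp
    let ?b = "b \<circ> Transposition.transpose i (Suc i)"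
    have bg: "b \<in> bid_grid I" and bM: "weighted_utility I b = ?M" using b by (auto simp: S_def)
    note tr = weighted_utility_transpose[OF valid bg i less]
    have "weighted_utility I ?b \<le> ?M" using finite_bid_grid tr(1) by (intro Max_ge) auto
    then have "?b \<in> S" using tr bM by (simp add: S_def)
    then have "\<phi> ?b \<le> \<phi> b" unfolding b(2) using finS by (intro Max_ge) auto
    moreover have split: "\<phi> c = (real ?n - real i) * c i + (real ?n - real (Suc i)) * c (Suc i) +
        (\<Sum>l\<in>{1..?n} - {i, Suc i}. (real ?n - real l) * c l)" for c
      unfolding \<phi>_def using i by (subst sum.subset_diff[of "{i, Suc i}"]) auto
    have "(\<Sum>l\<in>{1..?n} - {i, Suc i}. (real ?n - real l) * ?b l) =
        (\<Sum>l\<in>{1..?n} - {i, Suc i}. (real ?n - real l) * b l)"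
      by (intro sum.cong) (auto simp: Transposition.transpose_def)
    then have "\<phi> ?b = \<phi> b + (b (Suc i) - b i)"
      unfolding split[of b] split[of ?b] by (simp add: algebra_simps)
    ultimately show False using less by simp
  qed
  have "b l' \<le> b l" if "1 \<le> l" "l \<le> l'" "l' \<le> ?n" for l l'
    using that(2,3)
  proof (induction l' rule: dec_induct)
    case (step m)
    then show ?case using \<open>\<And>i. 1 \<le> i \<Longrightarrow> Suc i \<le> ?n \<Longrightarrow> b (Suc i) \<le> b i\<close>[of m] that(1) by linarith
  qed simp
  then have "antimono_on {1..?n} b" by (auto simp: monotone_on_def)
  then show ?thesis using b that by (auto simp: S_def)
qed

section \<open>Decomposition of the utility along a path\<close>

definition block_bid :: "wu_instance \<Rightarrow> nat \<Rightarrow> nat \<Rightarrow> nat \<Rightarrow> nat \<Rightarrow> real" where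
  "block_bid I i j k = (\<lambda>l\<in>{1..n_col I}. bid_val I (if l \<le> i then j else k))"

text \<open>Paths consist of indices into the bid values, with position 0 as a virtual start. Since
  the bid values are non-increasing, non-decreasing paths yield sorted strategies.\<close>

definition path_bid :: "wu_instance \<Rightarrow> (nat \<Rightarrow> nat) \<Rightarrow> nat \<Rightarrow> real" where
  "path_bid I p = (\<lambda>l\<in>{1..n_col I}. bid_val I (p l))"

definition gain :: "wu_instance \<Rightarrow> nat \<Rightarrow> nat \<Rightarrow> nat \<Rightarrow> real" where
  "gain I i j k = weighted_utility I (block_bid I i j k) - weighted_utility I (block_bid I i j j)"

lemma path_bid_in_grid:
  "(\<And>l. l \<in> {1..n_col I} \<Longrightarrow> p l \<in> {1..n_bids I}) \<Longrightarrow> path_bid I p \<in> bid_grid I"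
  by (auto simp: path_bid_def bid_grid_def)

lemma block_bid_in_grid:
  "j \<in> {1..n_bids I} \<Longrightarrow> k \<in> {1..n_bids I} \<Longrightarrow> block_bid I i j k \<in> bid_grid I"
  by (auto simp: block_bid_def bid_grid_def)

lemma path_bid_antimono:
  assumes "valid_instance I" "mono_on {1..n_col I} p" "p ` {1..n_col I} \<subseteq> {1..n_bids I}"
  shows "antimono_on {1..n_col I} (path_bid I p)"
proof (rule monotone_onI)
  fix l l' assume l: "l \<in> {1..n_col I}" "l' \<in> {1..n_col I}" "l \<le> l'"
  then have "p l \<in> {1..n_bids I}" "p l' \<in> {1..n_bids I}" using assms(3) by blast+
  then have "bid_val I (p l') \<le> bid_val I (p l)"
    using monotone_onD[OF assms(2) l] by (intro bid_val_antimono[OF assms(1)])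
  then show "path_bid I p l \<ge> path_bid I p l'" using l by (simp add: path_bid_def)
qed

text \<open>The two paths are frozen at \<open>i + 1\<close> and at \<open>i\<close>, so they differ
  only behind position \<open>i\<close>; flattening their common prefix turns them into block bids.
  For \<open>i = 0\<close> they are block bids already, with an empty first block.\<close>

lemma weighted_utility_exchange:
  assumes valid: "valid_instance I" and mono: "mono_on {0..n_col I} p"
    and p: "p ` {0..n_col I} \<subseteq> {1..n_bids I}" and i: "i < n_col I"
  shows "weighted_utility I (path_bid I (\<lambda>l. p (min l (Suc i)))) -
    weighted_utility I (path_bid I (\<lambda>l. p (min l i))) = gain I i (p i) (p (Suc i))"
proof (cases i)
  case 0
  then show ?thesis
    by (auto simp: gain_def path_bid_def block_bid_def intro!: arg_cong2[of _ _ _ _ "(-)"]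
      arg_cong[of _ _ "weighted_utility I"] restrict_ext)
next
  case (Suc i')
  then have i1: "i \<in> {1..n_col I}" using i by simp
  let ?P = "path_bid I (\<lambda>l. p (min l (Suc i)))" and ?Q = "path_bid I (\<lambda>l. p (min l i))"
  let ?P' = "block_bid I i (p i) (p (Suc i))" and ?Q' = "block_bid I i (p i) (p i)"
  have p': "p l \<in> {1..n_bids I}" if "l \<le> n_col I" for l using p that by (simp add: image_subset_iff)
  have grid: "?P \<in> bid_grid I" "?Q \<in> bid_grid I" "?P' \<in> bid_grid I" "?Q' \<in> bid_grid I"
    using i by (auto intro!: path_bid_in_grid block_bid_in_grid p' simp del: atLeastAtMost_iff)
  have "antimono_on {1..n_col I} (path_bid I (\<lambda>l. p (min l k)))" if "k \<le> n_col I" for k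
  proof (rule path_bid_antimono[OF valid])
    show "mono_on {1..n_col I} (\<lambda>l. p (min l k))"
      using that by (intro monotone_onI monotone_onD[OF mono]) auto
    show "(\<lambda>l. p (min l k)) ` {1..n_col I} \<subseteq> {1..n_bids I}"
      using p' that by (auto simp: min_le_iff_disj simp del: atLeastAtMost_iff)
  qed
  then have anti: "antimono_on {1..n_col I} ?P" "antimono_on {1..n_col I} ?Q" using i by simp_all
  have eq: "utility I (profile I ?P be) - utility I (profile I ?Q be) =
      utility I (profile I ?P' be) - utility I (profile I ?Q' be)" for be
    using i1 i by (intro utility_exchange[OF i1 anti]) (auto simp: path_bid_def block_bid_def min_def le_Suc_eq)
  show ?thesis
    unfolding gain_def
    using eq by (simp add: weighted_utility_grid[OF valid] grid flip: Bochner_Integration.integral_diff)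
qed

text \<open>Freezing at later and later positions telescopes from the constant path to
  \<open>p\<close>.\<close>

lemma weighted_utility_path:
  assumes valid: "valid_instance I" and mono: "mono_on {0..n_col I} p"
    and p: "p ` {0..n_col I} \<subseteq> {1..n_bids I}"
  shows "weighted_utility I (path_bid I p) =
    weighted_utility I (path_bid I (\<lambda>_. p 0)) + (\<Sum>i<n_col I. gain I i (p i) (p (Suc i)))"
proof -
  let ?f = "\<lambda>i. weighted_utility I (path_bid I (\<lambda>l. p (min l i)))"
  have "(\<Sum>i<n_col I. gain I i (p i) (p (Suc i))) = (\<Sum>i<n_col I. ?f (Suc i) - ?f i)"
    using weighted_utility_exchange[OF assms] by (intro sum.cong) auto
  also have "\<dots> = ?f (n_col I) - ?f 0" by (rule sum_lessThan_telescope)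
  also have "path_bid I (\<lambda>l. p (min l (n_col I))) = path_bid I p"
    by (auto simp: path_bid_def intro!: restrict_ext)
  finally show ?thesis by simp
qed

lemma exists_optimal_path:
  assumes valid: "valid_instance I"
  obtains p where "mono_on {0..n_col I} p" "p ` {0..n_col I} \<subseteq> {1..n_bids I}" "p 0 = 1"
    "weighted_utility I (path_bid I p) = Max (weighted_utility I ` bid_grid I)"
proof -
  obtain b where b: "b \<in> bid_grid I" "antimono_on {1..n_col I} b"
    "weighted_utility I b = Max (weighted_utility I ` bid_grid I)"
    using exists_sorted_optimum[OF valid] .
  \<comment> \<open>Bid values may repeat; taking the least index gives equal bids equal indices, as
    monotonicity requires. The virtual start 1 is below every index.\<close>
  define p where "p l = (if l = 0 then 1 else LEAST j. j \<in> {1..n_bids I} \<and> bid_val I j = b l)" for l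
  have p: "p l \<in> {1..n_bids I}" "bid_val I (p l) = b l" if "l \<in> {1..n_col I}" for l
  proof -
    have "\<exists>j. j \<in> {1..n_bids I} \<and> bid_val I j = b l"
      using b(1) that by (force simp: bid_grid_def PiE_iff)
    from LeastI_ex[OF this] show "p l \<in> {1..n_bids I}" "bid_val I (p l) = b l"
      using that by (auto simp: p_def)
  qed
  have le: "p l \<le> p l'" if l: "l \<in> {1..n_col I}" "l' \<in> {1..n_col I}" "l \<le> l'" for l l'
  proof (cases "b l = b l'")
    case False
    then have "b l' < b l" using b(2) l by (force simp: monotone_on_def)
    then have "\<not> p l' \<le> p l"
      using bid_val_antimono[OF valid p(1)[OF l(2)] p(1)[OF l(1)]] p(2)[OF l(1)] p(2)[OF l(2)] by auto
    then show ?thesis by simp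
  qed (use l in \<open>simp add: p_def\<close>)
  have "mono_on {0..n_col I} p"
  proof (rule monotone_onI)
    fix l l' assume l: "l \<in> {0..n_col I}" "l' \<in> {0..n_col I}" "l \<le> l'"
    have "p 0 = 1" by (simp add: p_def)
    then show "p l \<le> p l'" using l le[of l l'] p(1)[of l'] by (cases "l = 0"; cases "l' = 0") auto
  qed
  moreover have "p ` {0..n_col I} \<subseteq> {1..n_bids I}"
  proof
    fix x assume "x \<in> p ` {0..n_col I}"
    then obtain l where "l \<le> n_col I" "x = p l" by auto
    then show "x \<in> {1..n_bids I}"
      using p(1)[of l] valid by (cases "l = 0") (auto simp: p_def valid_instance_def)
  qed
  moreover have "path_bid I p = b"
    using b(1) p(2) by (auto simp: path_bid_def bid_grid_def PiE_iff extensional_def fun_eq_iff)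
  ultimately show ?thesis using that b(3) by (simp add: p_def)
qed

text \<open>\<open>best_gain I t j\<close> is the optimum over the last \<open>t\<close> steps of a path, started at \<open>j\<close>.\<close>

fun best_gain :: "wu_instance \<Rightarrow> nat \<Rightarrow> nat \<Rightarrow> real" where
  "best_gain I 0 j = 0"
| "best_gain I (Suc t) j =
     Max ((\<lambda>k. gain I (n_col I - Suc t) j k + best_gain I t k) ` {j..n_bids I})"

lemma path_gain_le_best:
  assumes "mono_on {0..n_col I} p" "p ` {0..n_col I} \<subseteq> {1..n_bids I}" "t \<le> n_col I"
  shows "(\<Sum>i = n_col I - t..<n_col I. gain I i (p i) (p (Suc i))) \<le> best_gain I t (p (n_col I - t))"
  using assms(3)
proof (induction t)
  case (Suc t)
  let ?i = "n_col I - Suc t"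
  have i: "Suc ?i = n_col I - t" using Suc.prems by simp
  have "p ?i \<le> p (Suc ?i)" "p (Suc ?i) \<le> n_bids I"
    using assms(1,2) Suc.prems by (auto simp: monotone_on_def image_subset_iff)
  then have "gain I ?i (p ?i) (p (Suc ?i)) + best_gain I t (p (Suc ?i)) \<le> best_gain I (Suc t) (p ?i)"
    by (auto intro: Max_ge)
  moreover have "(\<Sum>i = ?i..<n_col I. gain I i (p i) (p (Suc i))) =
      gain I ?i (p ?i) (p (Suc ?i)) + (\<Sum>i = Suc ?i..<n_col I. gain I i (p i) (p (Suc i)))"
    using Suc.prems by (intro sum.atLeast_Suc_lessThan) auto
  ultimately show ?case using Suc.IH Suc.prems by (simp add: i)
qed simp

text \<open>The Bellman equation at position \<open>i\<close>. Any maximizing successor is allowed,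
  so the table of the program is not tied to one choice among several optimal ones.\<close>

definition best_step :: "wu_instance \<Rightarrow> nat \<Rightarrow> nat \<Rightarrow> nat \<Rightarrow> bool" where
  "best_step I i j k \<longleftrightarrow> k \<in> {j..n_bids I} \<and>
     best_gain I (n_col I - i) j = gain I i j k + best_gain I (n_col I - Suc i) k"

text \<open>Such a chain collects exactly \<open>best_gain I (n_col I) 1\<close>, an upper bound for
  all paths from 1, and the common start makes the constant term equal. Steps are assumed only from
  valid indices, where the table is meaningful; validity is inherited along the chain.\<close>

lemma best_steps_optimal:
  assumes valid: "valid_instance I" and p0: "p 0 = 1"
    and step: "\<And>i. i < n_col I \<Longrightarrow> p i \<in> {1..n_bids I} \<Longrightarrow> best_step I i (p i) (p (Suc i))"
  shows "path_bid I p \<in> bid_grid I"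
    and "weighted_utility I (path_bid I p) = Max (weighted_utility I ` bid_grid I)"
proof -
  have ran: "p i \<in> {1..n_bids I}" if "i \<le> n_col I" for i
    using that
  proof (induction i)
    case 0
    then show ?case using valid p0 by (simp add: valid_instance_def)
  next
    case (Suc i)
    then have "p i \<in> {1..n_bids I}" "p (Suc i) \<in> {p i..n_bids I}"
      using step[of i] by (simp_all add: best_step_def)
    then show ?case by simp
  qed
  have "p i \<le> p j" if "i \<le> j" "j \<le> n_col I" for i j
    using that
  proof (induction j rule: dec_induct)
    case (step m)
    then have "p m \<le> p (Suc m)" using assms(3)[of m] ran[of m] by (simp add: best_step_def)
    then show ?case using step by simp
  qed simp
  then have mono: "mono_on {0..n_col I} p" by (auto simp: monotone_on_def)
  have sub: "p ` {0..n_col I} \<subseteq> {1..n_bids I}" using ran by auto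
  have "(\<Sum>i = n_col I - t..<n_col I. gain I i (p i) (p (Suc i))) = best_gain I t (p (n_col I - t))"
    if "t \<le> n_col I" for t
    using that
  proof (induction t)
    case (Suc t)
    let ?i = "n_col I - Suc t"
    have i: "Suc ?i = n_col I - t" "n_col I - ?i = Suc t" using Suc.prems by simp_all
    have "best_gain I (Suc t) (p ?i) = gain I ?i (p ?i) (p (Suc ?i)) + best_gain I t (p (Suc ?i))"
      using step[of ?i] ran[of ?i] Suc.prems unfolding best_step_def i by simp
    moreover have "(\<Sum>i = ?i..<n_col I. gain I i (p i) (p (Suc i))) =
        gain I ?i (p ?i) (p (Suc ?i)) + (\<Sum>i = Suc ?i..<n_col I. gain I i (p i) (p (Suc i)))"
      using Suc.prems by (intro sum.atLeast_Suc_lessThan) auto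
    ultimately show ?case using Suc.IH Suc.prems by (simp add: i del: best_gain.simps)
  qed simp
  from this[of "n_col I"] have sum: "(\<Sum>i<n_col I. gain I i (p i) (p (Suc i))) = best_gain I (n_col I) 1"
    by (simp add: p0 lessThan_atLeast0)
  obtain q where q: "mono_on {0..n_col I} q" "q ` {0..n_col I} \<subseteq> {1..n_bids I}" "q 0 = 1"
    "weighted_utility I (path_bid I q) = Max (weighted_utility I ` bid_grid I)"
    using exists_optimal_path[OF valid] .
  have "(\<Sum>i<n_col I. gain I i (q i) (q (Suc i))) \<le> best_gain I (n_col I) 1"
    using path_gain_le_best[OF q(1,2), of "n_col I"] by (simp add: q(3) lessThan_atLeast0)
  then have "Max (weighted_utility I ` bid_grid I) \<le> weighted_utility I (path_bid I p)"
    using weighted_utility_path[OF valid mono sub] weighted_utility_path[OF valid q(1,2)] sum q(3,4) p0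
    by simp
  moreover show grid: "path_bid I p \<in> bid_grid I" using ran by (intro path_bid_in_grid) auto
  then have "weighted_utility I (path_bid I p) \<le> Max (weighted_utility I ` bid_grid I)"
    using finite_bid_grid by (intro Max_ge) auto
  ultimately show "weighted_utility I (path_bid I p) = Max (weighted_utility I ` bid_grid I)" by simp
qed

section \<open>Lengths and costs\<close>

text \<open>
  \<open>small a x\<close> bounds the length of \<open>x\<close> by a quantity \<open>a\<close> that, unlike the length itself,
  is subadditive under all arithmetic operations.
\<close>

locale length_measure =
  fixes sz :: "real \<Rightarrow> nat" and small :: "nat \<Rightarrow> real \<Rightarrow> bool"
  assumes small_add: "small a x \<Longrightarrow> small b y \<Longrightarrow> small (a + b) (x + y)"
    and small_diff: "small a x \<Longrightarrow> small b y \<Longrightarrow> small (a + b) (x - y)"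
    and small_mult: "small a x \<Longrightarrow> small b y \<Longrightarrow> small (a + b) (x * y)"
    and small_of_nat: "small (Suc k) (real k)"
    and small_mono: "small a x \<Longrightarrow> a \<le> b \<Longrightarrow> small b x"
    and sz_le: "small a x \<Longrightarrow> sz x \<le> 3 * a + 5"

section \<open>The two length measures\<close>

lemma length_measure_unit: "length_measure unit_len (\<lambda>_ _. True)"
  by unfold_locales (simp_all add: unit_len_def)

text \<open>Magnitude and denominator are bounded rather than numerator and denominator: in a sum
  the magnitudes add and the denominators multiply, so the exponents merely add. The fraction may be
  unreduced. \<open>1 \<le> a\<close> gives \<open>2 ^ a + 2 ^ b \<le> 2 ^ (a + b)\<close>.\<close>

definition rat_small :: "nat \<Rightarrow> real \<Rightarrow> bool" where
  "rat_small a x \<longleftrightarrow> 1 \<le> a \<and> \<bar>x\<bar> \<le> 2 ^ a \<and>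
     (\<exists>p q :: int. 0 < q \<and> q \<le> 2 ^ a \<and> x = of_int p / of_int q)"

lemma floorlog_le_of_le_power:
  assumes "n \<le> 2 ^ a"
  shows "floorlog 2 n \<le> a + 1"
proof (rule floorlog_leI)
  have "(2::nat) ^ a < 2 ^ (a + 1)" by simp
  then have "n < 2 ^ (a + 1)" using assms by (rule order.strict_trans1[rotated])
  then show "n < 2 ^ (a + 1)" .
qed simp_all

lemma less_power_floorlog: "n < 2 ^ floorlog 2 n"
  by (cases "n = 0") (simp_all add: floorlog_bounds)

lemma rat_quotient:
  assumes "x \<in> \<rat>"
  obtains p q where "quotient_of (THE r. x = of_rat r) = (p, q)" "0 < q" "coprime p q"
    "x = of_int p / of_int q"
proof -
  obtain r where r: "x = of_rat r" using assms by (auto simp: Rats_def)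
  obtain p q where pq: "quotient_of r = (p, q)" by fastforce
  have "(THE r. x = of_rat r) = r" using r by auto
  moreover have "x = of_int p / of_int q"
    unfolding r quotient_of_div[OF pq] by (simp add: of_rat_divide)
  ultimately show ?thesis
    using that pq quotient_of_denom_pos[OF pq] quotient_of_coprime[OF pq] by simp
qed

lemma rat_small_rat_len:
  assumes "x \<in> \<rat>"
  shows "rat_small (rat_len x) x"
proof -
  obtain p q where pq: "quotient_of (THE r. x = of_rat r) = (p, q)" "0 < q" "coprime p q"
    "x = of_int p / of_int q"
    using rat_quotient[OF assms] .
  have len: "rat_len x = 3 + floorlog 2 (nat \<bar>p\<bar>) + floorlog 2 (nat q)"
    by (simp add: rat_len_def pq(1) nat_len_def)
  have bound: "k \<le> 2 ^ rat_len x" if "nat k < 2 ^ a" "a \<le> rat_len x" "0 \<le> k" for k :: int and a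
  proof -
    have "k < 2 ^ a" using that(1,3) by (simp add: nat_less_iff)
    also have "\<dots> \<le> 2 ^ rat_len x" using that(2) by (intro power_increasing) simp_all
    finally show ?thesis by simp
  qed
  have p: "\<bar>p\<bar> \<le> 2 ^ rat_len x"
    by (rule bound[OF less_power_floorlog]) (simp_all add: len)
  have q: "q \<le> 2 ^ rat_len x"
    by (rule bound[OF less_power_floorlog]) (use pq(2) in \<open>simp_all add: len\<close>)
  have "\<bar>x\<bar> \<le> of_int \<bar>p\<bar>"
    using pq(2) divide_left_mono[of 1 "real_of_int q" "of_int \<bar>p\<bar>"] by (simp add: pq(4))
  also have "\<dots> \<le> of_int (2 ^ rat_len x)" using p by (subst of_int_le_iff)
  finally have "\<bar>x\<bar> \<le> 2 ^ rat_len x" by simp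
  moreover have "1 \<le> rat_len x" by (simp add: len)
  ultimately show ?thesis using q pq(2,4) unfolding rat_small_def by blast
qed

text \<open>The reduced denominator divides the given one, so it is at most \<open>2 ^ a\<close>,
  and the reduced numerator is at most \<open>2 ^ (2 * a)\<close>. Their lengths, at most
  \<open>a + 1\<close> and \<open>2 * a + 1\<close>, and the three units in \<open>rat_len\<close>
  give \<open>3 * a + 5\<close>.\<close>

lemma rat_len_le:
  assumes "rat_small a x"
  shows "rat_len x \<le> 3 * a + 5"
proof -
  obtain p q where pq: "0 < q" "q \<le> 2 ^ a" "x = of_int p / of_int q" and xa: "\<bar>x\<bar> \<le> 2 ^ a"
    using assms by (auto simp: rat_small_def)
  have "x \<in> \<rat>" using pq(3) by simp
  then obtain p' q' where pq': "quotient_of (THE r. x = of_rat r) = (p', q')" "0 < q'" "coprime p' q'"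
    "x = of_int p' / of_int q'"
    by (rule rat_quotient)
  have "real_of_int (p' * q) = of_int (p * q')"
    using pq(1,3) pq'(2,4) by (simp add: field_simps)
  then have "p' * q = p * q'" by (simp only: of_int_eq_iff)
  then have "q' dvd p' * q" by simp
  then have "q' dvd q" using pq'(3) by (simp add: coprime_commute coprime_dvd_mult_right_iff)
  then have "q' \<le> q" using pq(1) by (rule zdvd_imp_le)
  then have q': "q' \<le> 2 ^ a" using pq(2) by simp
  have "real_of_int \<bar>p'\<bar> = \<bar>x\<bar> * of_int q'" using pq'(2,4) by (simp add: abs_mult)
  also have "real_of_int q' \<le> of_int (2 ^ a)" using q' by (simp only: of_int_le_iff)
  then have "\<bar>x\<bar> * of_int q' \<le> 2 ^ a * of_int (2 ^ a)"
    using xa pq'(2) by (intro mult_mono) simp_all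
  finally have "real_of_int \<bar>p'\<bar> \<le> of_int (2 ^ (2 * a))" by (simp add: power_add mult_2)
  then have p': "\<bar>p'\<bar> \<le> 2 ^ (2 * a)" by (simp only: of_int_le_iff)
  have "nat \<bar>p'\<bar> \<le> 2 ^ (2 * a)" "nat q' \<le> 2 ^ a" using p' q' by (simp_all add: nat_le_iff)
  from this[THEN floorlog_le_of_le_power] show ?thesis
    by (simp add: rat_len_def pq'(1) nat_len_def)
qed

text \<open>Expand \<open>(2 ^ a - 1) * (2 ^ b - 1)\<close>, a product of factors that are at least
  1.\<close>

lemma power_add_le: "1 \<le> a \<Longrightarrow> 1 \<le> b \<Longrightarrow> (2::real) ^ a + 2 ^ b \<le> 2 ^ (a + b)"
proof -
  assume "1 \<le> a" "1 \<le> b"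
  then have "(2::real) ^ 1 \<le> 2 ^ a" "(2::real) ^ 1 \<le> 2 ^ b" by (intro power_increasing; simp)+
  then have "0 \<le> (2 ^ a - 1) * (2 ^ b - 1) - (1::real)"
    using mult_mono[of 1 "2 ^ a - 1" 1 "2 ^ b - (1::real)"] by simp
  then show ?thesis by (simp add: algebra_simps power_add)
qed

lemma rat_small_ratI:
  assumes "1 \<le> a" "1 \<le> b" "0 < q" "q \<le> 2 ^ a" "0 < q'" "q' \<le> 2 ^ b"
    "x = of_int p / of_int (q * q')" "\<bar>x\<bar> \<le> 2 ^ (a + b)"
  shows "rat_small (a + b) x"
proof -
  have "q * q' \<le> 2 ^ (a + b)" using assms by (simp add: power_add mult_mono)
  then show ?thesis
    unfolding rat_small_def using assms
    by (intro conjI exI[of _ p] exI[of _ "q * q'"]) simp_all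
qed

lemma length_measure_rat: "length_measure rat_len rat_small"
proof
  fix a b x y assume "rat_small a x" "rat_small b y"
  then obtain p q p' q' where *: "1 \<le> a" "1 \<le> b" "0 < q" "q \<le> 2 ^ a" "0 < q'" "q' \<le> 2 ^ b"
    and x: "x = of_int p / of_int q" "\<bar>x\<bar> \<le> 2 ^ a" and y: "y = of_int p' / of_int q'" "\<bar>y\<bar> \<le> 2 ^ b"
    by (auto simp: rat_small_def)
  have sum: "2 ^ a + 2 ^ b \<le> (2::real) ^ (a + b)" using *(1,2) by (rule power_add_le)
  show "rat_small (a + b) (x + y)"
  proof (rule rat_small_ratI[OF *])
    show "x + y = of_int (p * q' + p' * q) / of_int (q * q')"
      using * by (simp add: x(1) y(1) add_frac_eq)
    show "\<bar>x + y\<bar> \<le> 2 ^ (a + b)" using sum x(2) y(2) by linarith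
  qed
  show "rat_small (a + b) (x - y)"
  proof (rule rat_small_ratI[OF *])
    show "x - y = of_int (p * q' - p' * q) / of_int (q * q')"
      using * by (simp add: x(1) y(1) diff_frac_eq)
    show "\<bar>x - y\<bar> \<le> 2 ^ (a + b)" using sum x(2) y(2) by linarith
  qed
  show "rat_small (a + b) (x * y)"
  proof (rule rat_small_ratI[OF *, where p = "p * p'"])
    show "\<bar>x * y\<bar> \<le> 2 ^ (a + b)" using x(2) y(2) by (simp add: abs_mult power_add mult_mono)
  qed (simp add: x y)
next
  fix k show "rat_small (Suc k) (real k)"
  proof -
    have "real k \<le> 2 ^ k" using less_exp[of k] by (metis less_imp_le of_nat_le_iff of_nat_numeral of_nat_power)
    also have "\<dots> \<le> 2 ^ Suc k" by simp
    finally show ?thesis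
      unfolding rat_small_def
      by (intro conjI exI[of _ "int k"] exI[of _ 1]) (simp_all del: power_Suc add: one_le_power)
  qed
next
  fix a b x assume x: "rat_small a x" and "a \<le> b"
  then have "(2::real) ^ a \<le> 2 ^ b" "(2::int) ^ a \<le> 2 ^ b"
    by (simp_all add: power_increasing)
  then have "\<bar>x\<bar> \<le> 2 ^ a \<Longrightarrow> \<bar>x\<bar> \<le> 2 ^ b" "q \<le> 2 ^ a \<Longrightarrow> q \<le> 2 ^ b" for q :: int
    by (auto intro: order_trans)
  then show "rat_small b x"
    using x order_trans[OF _ \<open>a \<le> b\<close>, of 1] unfolding rat_small_def by blast
qed (rule rat_len_le)

section \<open>Polynomial growth\<close>

definition poly_bounded :: "(nat \<Rightarrow> nat) \<Rightarrow> bool" where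
  "poly_bounded f \<longleftrightarrow> (\<exists>p :: nat poly. \<forall>x. f x \<le> poly p x)"

text \<open>Monotonicity, due to the natural coefficients, is what lets bounds be composed.\<close>

lemma poly_nat_mono:
  fixes p :: "nat poly"
  shows "x \<le> y \<Longrightarrow> poly p x \<le> poly p y"
  by (induction p) (auto intro: add_mono mult_mono)

lemma poly_bounded_const: "poly_bounded (\<lambda>_. c)"
  unfolding poly_bounded_def by (rule exI[of _ "[:c:]"]) simp

lemma poly_bounded_id: "poly_bounded (\<lambda>x. x)"
  unfolding poly_bounded_def by (rule exI[of _ "[:0, 1:]"]) simp

lemma poly_bounded_add: "poly_bounded f \<Longrightarrow> poly_bounded g \<Longrightarrow> poly_bounded (\<lambda>x. f x + g x)"
  unfolding poly_bounded_def by (metis add_mono poly_add)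

lemma poly_bounded_Suc: "poly_bounded f \<Longrightarrow> poly_bounded (\<lambda>x. Suc (f x))"
  using poly_bounded_add[OF _ poly_bounded_const[of 1]] by simp

lemma poly_bounded_mult: "poly_bounded f \<Longrightarrow> poly_bounded g \<Longrightarrow> poly_bounded (\<lambda>x. f x * g x)"
  unfolding poly_bounded_def by (metis mult_le_mono poly_mult)

lemma poly_bounded_compose:
  assumes "poly_bounded f" "poly_bounded g"
  shows "poly_bounded (\<lambda>x. f (g x))"
proof -
  obtain p q where "\<And>x. f x \<le> poly p x" "\<And>x. g x \<le> poly q x"
    using assms by (auto simp: poly_bounded_def)
  then have "f (g x) \<le> poly (pcompose p q) x" for x
    by (metis order_trans poly_nat_mono poly_pcompose)
  then show ?thesis by (auto simp: poly_bounded_def)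
qed

lemmas poly_bounded_intros =
  poly_bounded_const poly_bounded_id poly_bounded_Suc poly_bounded_add poly_bounded_mult

text \<open>
  Bounds for the value and the cost of an expression, and for the cost of a program, in states where
  all natural numbers are at most \<open>M\<close> and all numerical data are \<open>small M\<close>, provided that every
  loop makes at most \<open>M\<close> iterations.
\<close>

primrec nval_bound :: "nexp \<Rightarrow> nat \<Rightarrow> nat" where
  "nval_bound (NConst k) M = k"
| "nval_bound (NGet a e) M = M"
| "nval_bound (NAdd e e') M = nval_bound e M + nval_bound e' M"
| "nval_bound (NSub e e') M = nval_bound e M"
| "nval_bound (NMul e e') M = nval_bound e M * nval_bound e' M"

primrec ncost_bound :: "nexp \<Rightarrow> nat \<Rightarrow> nat" where
  "ncost_bound (NConst k) M = k + 1"
| "ncost_bound (NGet a e) M = ncost_bound e M + (M + 1)"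
| "ncost_bound (NAdd e e') M =
     ncost_bound e M + ncost_bound e' M + (nval_bound (NAdd e e') M + 1)"
| "ncost_bound (NSub e e') M =
     ncost_bound e M + ncost_bound e' M + (nval_bound (NSub e e') M + 1)"
| "ncost_bound (NMul e e') M =
     ncost_bound e M + ncost_bound e' M + (nval_bound (NMul e e') M + 1)"

primrec rval_bound :: "rexp \<Rightarrow> nat \<Rightarrow> nat" where
  "rval_bound (RNat e) M = nval_bound e M + 1"
| "rval_bound (RGet a e) M = M"
| "rval_bound (RAdd e e') M = rval_bound e M + rval_bound e' M"
| "rval_bound (RSub e e') M = rval_bound e M + rval_bound e' M"
| "rval_bound (RMul e e') M = rval_bound e M + rval_bound e' M"

primrec rcost_bound :: "rexp \<Rightarrow> nat \<Rightarrow> nat" where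
  "rcost_bound (RNat e) M = ncost_bound e M + (3 * rval_bound (RNat e) M + 5)"
| "rcost_bound (RGet a e) M = ncost_bound e M + (3 * rval_bound (RGet a e) M + 5)"
| "rcost_bound (RAdd e e') M =
     rcost_bound e M + rcost_bound e' M + (3 * rval_bound (RAdd e e') M + 5)"
| "rcost_bound (RSub e e') M =
     rcost_bound e M + rcost_bound e' M + (3 * rval_bound (RSub e e') M + 5)"
| "rcost_bound (RMul e e') M =
     rcost_bound e M + rcost_bound e' M + (3 * rval_bound (RMul e e') M + 5)"

primrec bcost_bound :: "bexp \<Rightarrow> nat \<Rightarrow> nat" where
  "bcost_bound (NLess e e') M = ncost_bound e M + ncost_bound e' M + 1"
| "bcost_bound (RLess e e') M = rcost_bound e M + rcost_bound e' M + 1"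
| "bcost_bound (BNot b) M = bcost_bound b M + 1"
| "bcost_bound (BAnd b b') M = bcost_bound b M + bcost_bound b' M + 1"

primrec cost_bound :: "com \<Rightarrow> nat \<Rightarrow> nat" where
  "cost_bound Skip M = 1"
| "cost_bound (NAssign a e e') M = ncost_bound e M + ncost_bound e' M + 1"
| "cost_bound (RAssign a e e') M = ncost_bound e M + rcost_bound e' M + 1"
| "cost_bound (Seq c c') M = cost_bound c M + cost_bound c' M"
| "cost_bound (If b c c') M = bcost_bound b M + (cost_bound c M + cost_bound c' M)"
| "cost_bound (While b c) M = M * (bcost_bound b M + cost_bound c M) + bcost_bound b M"
| "cost_bound (Query a r p) M = 1"

lemma poly_bounded_nval_bound: "poly_bounded (nval_bound e)"
  by (induction e) (auto intro!: poly_bounded_intros)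

lemma poly_bounded_ncost_bound: "poly_bounded (ncost_bound e)"
  by (induction e) (auto intro!: poly_bounded_intros poly_bounded_nval_bound)

lemma poly_bounded_rval_bound: "poly_bounded (rval_bound e)"
  by (induction e) (auto intro!: poly_bounded_intros poly_bounded_nval_bound)

lemma poly_bounded_rcost_bound: "poly_bounded (rcost_bound e)"
  by (induction e)
    (auto intro!: poly_bounded_intros poly_bounded_nval_bound poly_bounded_rval_bound poly_bounded_ncost_bound)

lemma poly_bounded_bcost_bound: "poly_bounded (bcost_bound b)"
  by (induction b) (auto intro!: poly_bounded_intros poly_bounded_ncost_bound poly_bounded_rcost_bound)

lemma poly_bounded_cost_bound: "poly_bounded (cost_bound c)"
  by (induction c)
    (auto intro!: poly_bounded_intros poly_bounded_ncost_bound poly_bounded_rcost_bound poly_bounded_bcost_bound)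

lemma nat_len_le: "nat_len k \<le> k + 1"
proof -
  have "floorlog 2 k \<le> k" by (rule floorlog_leI) (simp_all add: less_exp)
  then show ?thesis by (simp add: nat_len_def)
qed

section \<open>Proof rules for bounded runs\<close>

locale bounded_exec = length_measure +
  fixes I :: wu_instance and M :: nat
begin

definition bounded_state :: "state \<Rightarrow> bool" where
  "bounded_state s \<longleftrightarrow> (\<forall>a i. narr s a i \<le> M) \<and> (\<forall>a i. small M (rarr s a i))"

text \<open>Total correctness with a cost bound read off the syntax. The rules never track costs;
  they ask only that stored values stay bounded and that loops have a variant starting at most at
  \<open>M\<close>.\<close>

definition run :: "state \<Rightarrow> com \<Rightarrow> (state \<Rightarrow> bool) \<Rightarrow> bool" where
  "run s c Q \<longleftrightarrow> (\<exists>t T. exec sz I c s t T \<and> T \<le> cost_bound c M \<and> bounded_state t \<and> Q t)"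

lemma nval_le:
  assumes "bounded_state s"
  shows "nval e s \<le> nval_bound e M"
  using assms by (induction e) (auto simp: bounded_state_def intro: add_mono mult_le_mono)

lemma ncost_le:
  assumes "bounded_state s"
  shows "ncost e s \<le> ncost_bound e M"
proof -
  have *: "nat_len (nval e s) \<le> nval_bound e M + 1" for e
    using nat_len_le[of "nval e s"] nval_le[OF assms, of e] by simp
  show ?thesis
  proof (induction e)
    case (NConst k)
    then show ?case using nat_len_le[of k] by simp
  next
    case (NGet a e)
    then show ?case using *[of "NGet a e"] by simp
  next
    case (NAdd e e')
    then show ?case using *[of "NAdd e e'"] by simp
  next
    case (NSub e e')
    then show ?case using *[of "NSub e e'"] by simp
  next
    case (NMul e e')
    then show ?case using *[of "NMul e e'"] by simp
  qed
qed

lemma rval_small: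
  assumes "bounded_state s"
  shows "small (rval_bound e M) (rval e s)"
proof (induction e)
  case (RNat e)
  then show ?case
    using small_mono[OF small_of_nat, of "nval e s" "nval_bound e M + 1"] nval_le[OF assms, of e] by simp
next
  case (RGet a e)
  then show ?case using assms by (simp add: bounded_state_def)
qed (simp_all add: small_add small_diff small_mult)

lemma rcost_le:
  assumes "bounded_state s"
  shows "rcost sz e s \<le> rcost_bound e M"
proof -
  have *: "sz (rval e s) \<le> 3 * rval_bound e M + 5" for e by (rule sz_le[OF rval_small[OF assms]])
  show ?thesis
  proof (induction e)
    case (RNat e)
    then show ?case using *[of "RNat e"] ncost_le[OF assms, of e] by simp
  next
    case (RGet a e)
    then show ?case using *[of "RGet a e"] ncost_le[OF assms, of e] by simp
  next
    case (RAdd e e')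
    then show ?case using *[of "RAdd e e'"] by simp
  next
    case (RSub e e')
    then show ?case using *[of "RSub e e'"] by simp
  next
    case (RMul e e')
    then show ?case using *[of "RMul e e'"] by simp
  qed
qed

lemma bcost_le:
  assumes "bounded_state s"
  shows "bcost sz b s \<le> bcost_bound b M"
  by (induction b) (simp_all add: add_mono ncost_le[OF assms] rcost_le[OF assms])

lemma run_mono:
  "run s c Q \<Longrightarrow> (\<And>t. bounded_state t \<Longrightarrow> Q t \<Longrightarrow> Q' t) \<Longrightarrow> run s c Q'"
  unfolding run_def by blast

lemma run_Skip: "bounded_state s \<Longrightarrow> Q s \<Longrightarrow> run s Skip Q"
  unfolding run_def using exec.Skip by fastforce

lemma run_NAssign:
  assumes "bounded_state s" "nval e' s \<le> M"
    and "bounded_state (nupd a (nval e s) (nval e' s) s) \<Longrightarrow> Q (nupd a (nval e s) (nval e' s) s)"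
  shows "run s (NAssign a e e') Q"
proof -
  have "bounded_state (nupd a (nval e s) (nval e' s) s)"
    using assms(1,2) by (auto simp: bounded_state_def nupd_def)
  moreover have "ncost e s + ncost e' s + 1 \<le> cost_bound (NAssign a e e') M"
    using ncost_le[OF assms(1)] by (simp add: add_mono)
  ultimately show ?thesis unfolding run_def using assms(3) exec.NAssign by blast
qed

text \<open>Only the stored value has to be small; intermediate values are charged through
  \<open>rval_bound\<close>.\<close>

lemma run_RAssign:
  assumes "bounded_state s" "small M (rval e' s)"
    and "bounded_state (rupd a (nval e s) (rval e' s) s) \<Longrightarrow> Q (rupd a (nval e s) (rval e' s) s)"
  shows "run s (RAssign a e e') Q"
proof -
  have "bounded_state (rupd a (nval e s) (rval e' s) s)"
    using assms(1,2) by (auto simp: bounded_state_def rupd_def)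
  moreover have "ncost e s + rcost sz e' s + 1 \<le> cost_bound (RAssign a e e') M"
    using ncost_le[OF assms(1)] rcost_le[OF assms(1)] by (simp add: add_mono)
  ultimately show ?thesis unfolding run_def using assms(3) exec.RAssign by blast
qed

lemma run_Seq:
  assumes "run s c (\<lambda>t. run t c' Q)"
  shows "run s (Seq c c') Q"
proof -
  obtain t T t' T' where "exec sz I c s t T" "T \<le> cost_bound c M"
    "exec sz I c' t t' T'" "T' \<le> cost_bound c' M" "bounded_state t'" "Q t'"
    using assms unfolding run_def by blast
  then show ?thesis
    unfolding run_def by (intro exI[of _ t'] exI[of _ "T + T'"]) (auto intro: exec.Seq)
qed

lemma run_If:
  assumes "bounded_state s" "bval b s \<Longrightarrow> run s c Q" "\<not> bval b s \<Longrightarrow> run s c' Q"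
  shows "run s (If b c c') Q"
proof (cases "bval b s")
  case True
  then obtain t T where "exec sz I c s t T" "T \<le> cost_bound c M" "bounded_state t" "Q t"
    using assms(2) unfolding run_def by blast
  then show ?thesis
    unfolding run_def using True bcost_le[OF assms(1), of b]
    by (intro exI[of _ t] exI[of _ "bcost sz b s + T"]) (auto intro: exec.IfTrue)
next
  case False
  then obtain t T where "exec sz I c' s t T" "T \<le> cost_bound c' M" "bounded_state t" "Q t"
    using assms(3) unfolding run_def by blast
  then show ?thesis
    unfolding run_def using False bcost_le[OF assms(1), of b]
    by (intro exI[of _ t] exI[of _ "bcost sz b s + T"]) (auto intro: exec.IfFalse)
qed

lemma run_While:
  fixes f :: "state \<Rightarrow> nat"
  assumes "bounded_state s" "Inv s" "f s \<le> M"
    and step: "\<And>s. bounded_state s \<Longrightarrow> Inv s \<Longrightarrow> bval b s \<Longrightarrow> run s c (\<lambda>t. Inv t \<and> f t < f s)"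
    and exit: "\<And>t. bounded_state t \<Longrightarrow> Inv t \<Longrightarrow> \<not> bval b t \<Longrightarrow> Q t"
  shows "run s (While b c) Q"
proof -
  let ?B = "bcost_bound b M" and ?C = "cost_bound c M"
  \<comment> \<open>The static bound counts \<open>M\<close> iterations; the induction needs the
    number \<open>f s\<close> that may still follow.\<close>
  have "\<exists>t T. exec sz I (While b c) s t T \<and> T \<le> f s * (?B + ?C) + ?B \<and> bounded_state t \<and> Q t"
    using assms(1,2)
  proof (induction "f s" arbitrary: s rule: less_induct)
    case less
    show ?case
    proof (cases "bval b s")
      case False
      then have "exec sz I (While b c) s s (bcost sz b s)" by (rule exec.WhileFalse)
      moreover have "bcost sz b s \<le> f s * (?B + ?C) + ?B"
        using bcost_le[OF less.prems(1), of b] by simp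
      ultimately show ?thesis using exit[OF less.prems False] less.prems(1) by blast
    next
      case True
      obtain s' T where s': "exec sz I c s s' T" "T \<le> ?C" "bounded_state s'" "Inv s'" "f s' < f s"
        using step[OF less.prems True] unfolding run_def by blast
      obtain t T' where t: "exec sz I (While b c) s' t T'" "T' \<le> f s' * (?B + ?C) + ?B"
        "bounded_state t" "Q t"
        using less.hyps[OF s'(5,3,4)] by blast
      have "bcost sz b s + T + T' \<le> Suc (f s') * (?B + ?C) + ?B"
        using bcost_le[OF less.prems(1), of b] s'(2) t(2) by simp
      also have "\<dots> \<le> f s * (?B + ?C) + ?B"
        using s'(5) by (intro add_right_mono mult_right_mono) simp_all
      finally show ?thesis using exec.WhileTrue[OF True s'(1) t(1)] t(3,4) by blast
    qed
  qed
  then obtain t T where t: "exec sz I (While b c) s t T" "T \<le> f s * (?B + ?C) + ?B"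
    "bounded_state t" "Q t" by blast
  have "f s * (?B + ?C) \<le> M * (?B + ?C)" using assms(3) by (intro mult_right_mono) simp_all
  then have "T \<le> cost_bound (While b c) M" using t(2) unfolding cost_bound.simps by linarith
  then show ?thesis unfolding run_def using t by blast
qed

lemma run_Query:
  assumes "bounded_state s" "bc = load_vec (n_col I) a s"
    and "\<And>i. i \<in> {1..n_col I} \<Longrightarrow> bc i \<in> {0..1}"
    and "\<And>i. i \<in> {1..n_col I} \<Longrightarrow> small M (exp_revenue I bc i) \<and> small M (exp_payment I bc i)"
    and "bounded_state (store_vec (n_col I) p (exp_payment I bc) (store_vec (n_col I) r (exp_revenue I bc) s)) \<Longrightarrow>
      Q (store_vec (n_col I) p (exp_payment I bc) (store_vec (n_col I) r (exp_revenue I bc) s))"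
  shows "run s (Query a r p) Q"
proof -
  let ?t = "store_vec (n_col I) p (exp_payment I bc) (store_vec (n_col I) r (exp_revenue I bc) s)"
  have "bounded_state ?t" using assms(1,4) by (auto simp: bounded_state_def store_vec_def)
  moreover have "exec sz I (Query a r p) s ?t 1" using assms(2,3) by (intro exec.Query) auto
  ultimately show ?thesis unfolding run_def using assms(5) by fastforce
qed

end

section \<open>The dynamic program\<close>

abbreviation "var a \<equiv> NGet a (NConst 0)"

definition col_exp :: nexp where "col_exp = NGet 0 (NConst 1)"
definition bids_exp :: nexp where "bids_exp = NGet 0 (NConst 4)"
definition cell_exp :: "nat \<Rightarrow> nexp" where
  "cell_exp j = NAdd (NMul (var 1) (NAdd bids_exp (NConst 1))) (var j)"
definition incr :: "nat \<Rightarrow> com" where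
  "incr a = NAssign a (NConst 0) (NAdd (var a) (NConst 1))"

text \<open>
  Arrays of natural numbers: cells 0 of 1 to 4 and 6 are variables \<open>i\<close>, \<open>j\<close>, \<open>k\<close>, \<open>l\<close>
  and the current bid index; 5 holds the optimal steps, with step \<open>i\<close> from \<open>j\<close> in cell
  \<open>i * (d + 1) + j\<close>. Arrays of numerical data: 6 is the query, 7 and 8 are its answers, cells 0 of 9
  and 10 are accumulators, and cell \<open>j\<close> of 11 is the optimal gain from \<open>j\<close>.
\<close>

definition fill_prog :: com where
  "fill_prog = Seq (NAssign 4 (NConst 0) (NConst 0))
     (While (NLess (var 4) col_exp)
       (Seq (incr 4)
         (If (NLess (var 1) (var 4))
           (RAssign 6 (var 4) (RGet 2 (var 3)))
           (RAssign 6 (var 4) (RGet 2 (var 2))))))"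

definition sum_prog :: com where
  "sum_prog = Seq (NAssign 4 (NConst 0) (NConst 0)) (Seq (RAssign 9 (NConst 0) (RNat (NConst 0)))
     (While (NLess (var 4) col_exp)
       (Seq (incr 4)
         (RAssign 9 (NConst 0) (RAdd (RGet 9 (NConst 0))
           (RSub (RMul (RGet 3 (var 4)) (RGet 7 (var 4)))
             (RMul (RGet 4 (NConst 0)) (RGet 8 (var 4)))))))))"

definition eval_prog :: com where
  "eval_prog = Seq fill_prog (Seq (Query 6 7 8) sum_prog)"

text \<open>The candidate \<open>k = j\<close> needs no update of array 11: its gain is 0, so cell
  \<open>j\<close> already holds its value. The loop runs over larger \<open>k\<close> and thus
  reads values of the previous stage even after cell \<open>j\<close> is overwritten.\<close>

definition step_prog :: com where
  "step_prog = Seq (NAssign 3 (NConst 0) (var 2)) (Seq eval_prog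
     (Seq (RAssign 10 (NConst 0) (RGet 9 (NConst 0))) (Seq (NAssign 5 (cell_exp 2) (var 2))
       (While (NLess (var 3) bids_exp)
         (Seq (incr 3) (Seq eval_prog
           (Seq (RAssign 9 (NConst 0)
               (RAdd (RSub (RGet 9 (NConst 0)) (RGet 10 (NConst 0))) (RGet 11 (var 3))))
             (If (RLess (RGet 11 (var 2)) (RGet 9 (NConst 0)))
               (Seq (RAssign 11 (var 2) (RGet 9 (NConst 0))) (NAssign 5 (cell_exp 2) (var 3)))
               Skip))))))))"

text \<open>Taking \<open>j\<close> upwards allows array 11 to be updated in place, as step
  \<open>j\<close> reads only cells from \<open>j\<close> on.\<close>

definition stage_prog :: com where
  "stage_prog = Seq (NAssign 2 (NConst 0) (NConst 0))
     (While (NLess (var 2) bids_exp) (Seq (incr 2) step_prog))"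

text \<open>The initial zeros of array 11 are the optimal gains with no steps left.\<close>

definition table_prog :: com where
  "table_prog = Seq (NAssign 1 (NConst 0) col_exp)
     (While (NLess (NConst 0) (var 1))
       (Seq (NAssign 1 (NConst 0) (NSub (var 1) (NConst 1))) stage_prog))"

text \<open>Index 1 is the virtual start of the path. The table is read before the position is
  increased: step \<open>i\<close> yields bid \<open>i + 1\<close>.\<close>

definition output_prog :: com where
  "output_prog = Seq (NAssign 6 (NConst 0) (NConst 1)) (Seq (NAssign 1 (NConst 0) (NConst 0))
     (While (NLess (var 1) col_exp)
       (Seq (NAssign 6 (NConst 0) (NGet 5 (cell_exp 6)))
         (Seq (incr 1) (RAssign 5 (var 1) (RGet 2 (var 6)))))))"

definition solver :: com where
  "solver = Seq table_prog output_prog"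

definition input_kept :: "wu_instance \<Rightarrow> state \<Rightarrow> bool" where
  "input_kept I s \<longleftrightarrow>
     narr s 0 = narr (input_state I) 0 \<and> (\<forall>a<5. rarr s a = rarr (input_state I) a)"

lemma input_kept_simps:
  assumes "input_kept I s"
  shows "nval col_exp s = n_col I" "nval bids_exp s = n_bids I"
    and "nval (cell_exp j) s = narr s 1 0 * (n_bids I + 1) + narr s j 0"
    and "j \<in> {1..n_bids I} \<Longrightarrow> rarr s 2 j = bid_val I j"
    and "i \<in> {1..n_col I} \<Longrightarrow> rarr s 3 i = y_wt I i"
    and "rarr s 4 0 = x_wt I"
  using assms by (simp_all add: input_kept_def col_exp_def bids_exp_def cell_exp_def input_state_def)

lemma narr_nupd: "narr (nupd a i x s) = (narr s)(a := (narr s a)(i := x))"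
  and rarr_nupd: "rarr (nupd a i x s) = rarr s"
  and narr_rupd: "narr (rupd a i y s) = narr s"
  and rarr_rupd: "rarr (rupd a i y s) = (rarr s)(a := (rarr s a)(i := y))"
  by (simp_all add: nupd_def rupd_def)

lemma narr_store_vec: "narr (store_vec n a f s) = narr s"
  and rarr_store_vec:
    "rarr (store_vec n a f s) = (rarr s)(a := (\<lambda>i. if i \<in> {1..n} then f i else rarr s a i))"
  by (simp_all add: store_vec_def)

lemmas state_simps = narr_nupd rarr_nupd narr_rupd rarr_rupd narr_store_vec rarr_store_vec

text \<open>Division by \<open>d + 1\<close> recovers the row; this width leaves room for column
  indices up to \<open>d\<close>.\<close>

lemma cell_eq_iff:
  assumes "j \<le> d" "j' \<le> (d :: nat)"
  shows "i * (d + 1) + j = i' * (d + 1) + j' \<longleftrightarrow> i = i' \<and> j = j'"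
proof
  assume eq: "i * (d + 1) + j = i' * (d + 1) + j'"
  have "(i * (d + 1) + j) div (d + 1) = i" "(i' * (d + 1) + j') div (d + 1) = i'"
    using assms by (simp_all add: div_mult_self3 del: mult_Suc_right add_Suc_right)
  then have "i = i'" using eq by simp
  then show "i = i' \<and> j = j'" using eq by simp
qed simp

text \<open>The last bound on \<open>M\<close>: a summand of the utility has two products of numbers
  of length \<open>L\<close>, hence \<open>4 * L\<close>; \<open>n_col I\<close> summands and the
  initial 0 give \<open>4 * L * n_col I + 1\<close>; a gain doubles this; a candidate adds at most
  \<open>n_col I + 1\<close> gains and another 0.\<close>

locale solver_run = bounded_exec +
  fixes L :: nat
  assumes valid: "valid_instance I"
    and small_input: "\<And>x. x \<in> set (input_numbers I) \<Longrightarrow> small L x"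
    and small_answers: "\<And>x. x \<in> oracle_answers I \<Longrightarrow> small L x"
    and M: "n_agents I \<le> M" "n_slots I \<le> M" "n_bids I \<le> M" "L \<le> M"
      "(n_col I + 1) * (2 * (4 * L * n_col I + 1)) + 1 \<le> M"
begin

definition F :: "nat \<Rightarrow> nat \<Rightarrow> nat \<Rightarrow> real" where
  "F i j k = weighted_utility I (block_bid I i j k)"

lemma gain_eq: "gain I i j k = F i j k - F i j j"
  by (simp add: gain_def F_def)

lemma n_col_le: "n_col I \<le> M"
  using M(1) by (simp add: n_agents_def)

lemma M_pos: "1 \<le> M"
  using M(5) by simp

lemma n_bids_pos: "1 \<le> n_bids I"
  using valid by (simp add: valid_instance_def)

lemma small_y: "i \<in> {1..n_col I} \<Longrightarrow> small L (y_wt I i)"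
  by (rule small_input) (auto simp: input_numbers_def simp del: upt_Suc)

lemma small_x: "small L (x_wt I)"
  by (rule small_input) (simp add: input_numbers_def)

lemma small_zero: "1 \<le> a \<Longrightarrow> small a 0"
  using small_mono[OF small_of_nat[of 0]] by simp

lemma small_oracle:
  assumes "bc \<in> bid_grid I" "i \<in> {1..n_col I}"
  shows "small L (exp_revenue I bc i)" "small L (exp_payment I bc i)"
  by (rule small_answers; use assms in \<open>unfold oracle_answers_def, blast\<close>)+

text \<open>Partial sums are included because the accumulator of \<open>sum_prog\<close> holds
  them.\<close>

lemma small_partial_utility:
  assumes "bc \<in> bid_grid I" "l \<le> n_col I"
  shows "small (4 * L * l + 1)
    (\<Sum>i = 1..l. y_wt I i * exp_revenue I bc i - x_wt I * exp_payment I bc i)"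
  using assms(2)
proof (induction l)
  case (Suc l)
  have "small (L + L + (L + L))
      (y_wt I (Suc l) * exp_revenue I bc (Suc l) - x_wt I * exp_payment I bc (Suc l))"
    using Suc.prems
    by (intro small_diff small_mult small_y small_x small_oracle[OF assms(1)]) simp_all
  with Suc.IH Suc.prems have "small (4 * L * l + 1 + (L + L + (L + L)))
      ((\<Sum>i = 1..l. y_wt I i * exp_revenue I bc i - x_wt I * exp_payment I bc i) +
       (y_wt I (Suc l) * exp_revenue I bc (Suc l) - x_wt I * exp_payment I bc (Suc l)))"
    by (intro small_add) simp_all
  then show ?case by (simp add: algebra_simps)
qed (simp add: small_zero)

lemma small_partial_utility_M:
  assumes "bc \<in> bid_grid I" "l \<le> n_col I"
  shows "small M (\<Sum>i = 1..l. y_wt I i * exp_revenue I bc i - x_wt I * exp_payment I bc i)"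
proof (rule small_mono[OF small_partial_utility[OF assms]])
  have "4 * L * l + 1 \<le> 4 * L * n_col I + 1" using assms(2) by simp
  also have "\<dots> \<le> (n_col I + 1) * (2 * (4 * L * n_col I + 1)) + 1" by simp
  finally show "4 * L * l + 1 \<le> M" using M(5) by simp
qed

lemma small_gain:
  assumes "j \<in> {1..n_bids I}" "k \<in> {1..n_bids I}"
  shows "small (2 * (4 * L * n_col I + 1)) (gain I i j k)"
proof -
  have F: "small (4 * L * n_col I + 1) (F i j k)" if "k \<in> {1..n_bids I}" for k
    unfolding F_def weighted_utility_def using assms that
    by (intro small_partial_utility block_bid_in_grid) simp_all
  from small_diff[OF F[OF assms(2)] F[OF assms(1)]] show ?thesis
    by (simp add: gain_eq mult_2)
qed

lemma best_gain_attained: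
  assumes "j \<in> {1..n_bids I}"
  obtains k where "k \<in> {j..n_bids I}"
    "best_gain I (Suc t) j = gain I (n_col I - Suc t) j k + best_gain I t k"
proof -
  have "best_gain I (Suc t) j \<in> (\<lambda>k. gain I (n_col I - Suc t) j k + best_gain I t k) ` {j..n_bids I}"
    unfolding best_gain.simps using assms by (intro Max_in) auto
  then show ?thesis using that by auto
qed

lemma small_best_gain:
  assumes "j \<in> {1..n_bids I}"
  shows "small (t * (2 * (4 * L * n_col I + 1)) + 1) (best_gain I t j)"
  using assms
proof (induction t arbitrary: j)
  case (Suc t)
  obtain k where k: "k \<in> {j..n_bids I}"
    "best_gain I (Suc t) j = gain I (n_col I - Suc t) j k + best_gain I t k"
    using best_gain_attained[OF Suc.prems] .
  have "k \<in> {1..n_bids I}" using k(1) Suc.prems by simp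
  from small_add[OF small_gain[OF Suc.prems this] Suc.IH[OF this]] show ?case
    unfolding k(2) by (simp add: algebra_simps)
qed (simp add: small_zero)

lemma small_candidate:
  assumes "j \<in> {1..n_bids I}" "k \<in> {1..n_bids I}" "t \<le> n_col I"
  shows "small M (gain I i j k + best_gain I t k)"
proof (rule small_mono[OF small_add[OF small_gain[OF assms(1,2)] small_best_gain[OF assms(2)]]])
  have "2 * (4 * L * n_col I + 1) + (t * (2 * (4 * L * n_col I + 1)) + 1) =
      (t + 1) * (2 * (4 * L * n_col I + 1)) + 1" by (simp add: algebra_simps)
  also have "\<dots> \<le> (n_col I + 1) * (2 * (4 * L * n_col I + 1)) + 1"
    using assms(3) by (intro add_right_mono mult_right_mono) simp_all
  finally show "2 * (4 * L * n_col I + 1) + (t * (2 * (4 * L * n_col I + 1)) + 1) \<le> M"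
    using M(5) by simp
qed

lemma small_state: "bounded_state s \<Longrightarrow> small M (rarr s a i)"
  and nat_state: "bounded_state s \<Longrightarrow> narr s a i \<le> M"
  by (simp_all add: bounded_state_def)

section \<open>Correctness of the subprograms\<close>

lemma run_incr:
  assumes "bounded_state s" "narr s a 0 < M"
    and "bounded_state (nupd a 0 (narr s a 0 + 1) s) \<Longrightarrow> Q (nupd a 0 (narr s a 0 + 1) s)"
  shows "run s (incr a) Q"
  unfolding incr_def using assms by (intro run_NAssign) simp_all

text \<open>The frame clauses single out the arrays that may change, so that variables and tables of
  the enclosing loops survive.\<close>

lemma run_fill:
  assumes s: "bounded_state s" "input_kept I s"
    and ijk: "narr s 1 0 = i" "narr s 2 0 = j" "narr s 3 0 = k" "j \<in> {1..n_bids I}" "k \<in> {1..n_bids I}"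
  shows "run s fill_prog (\<lambda>t. (\<forall>a. a \<noteq> 4 \<longrightarrow> narr t a = narr s a) \<and>
    (\<forall>a. a \<noteq> 6 \<longrightarrow> rarr t a = rarr s a) \<and> load_vec (n_col I) 6 t = block_bid I i j k)"
  unfolding fill_prog_def
proof (rule run_Seq, rule run_NAssign[OF s(1)])
  let ?Inv = "\<lambda>t. narr t 4 0 \<le> n_col I \<and> (\<forall>a. a \<noteq> 4 \<longrightarrow> narr t a = narr s a) \<and>
    (\<forall>a. a \<noteq> 6 \<longrightarrow> rarr t a = rarr s a) \<and>
    (\<forall>l\<in>{1..narr t 4 0}. rarr t 6 l = bid_val I (if l \<le> i then j else k))"
  have kept: "input_kept I t" if "?Inv t" for t using s(2) that by (auto simp: input_kept_def)
  have stop: "narr t 4 0 = n_col I" if "?Inv t" "\<not> bval (NLess (var 4) col_exp) t" for t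
    using that(2) conjunct1[OF that(1)] by (simp add: input_kept_simps(1)[OF kept[OF that(1)]])
  assume bs: "bounded_state (nupd 4 (nval (NConst 0) s) (nval (NConst 0) s) s)" (is "bounded_state ?s")
  show "run ?s (While (NLess (var 4) col_exp) (Seq (incr 4)
      (If (NLess (var 1) (var 4)) (RAssign 6 (var 4) (RGet 2 (var 3)))
        (RAssign 6 (var 4) (RGet 2 (var 2))))))
    (\<lambda>t. (\<forall>a. a \<noteq> 4 \<longrightarrow> narr t a = narr s a) \<and>
      (\<forall>a. a \<noteq> 6 \<longrightarrow> rarr t a = rarr s a) \<and> load_vec (n_col I) 6 t = block_bid I i j k)"
  proof (rule run_While[where Inv = ?Inv and f = "\<lambda>t. n_col I - narr t 4 0"])
    fix t assume t: "bounded_state t" "?Inv t" "bval (NLess (var 4) col_exp) t"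
    let ?l = "narr t 4 0"
    have l: "?l < n_col I" using t(3) input_kept_simps(1)[OF kept[OF t(2)]] by simp
    have vars: "narr t 1 0 = i" "narr t 2 0 = j" "narr t 3 0 = k" using t(2) ijk by simp_all
    have bids: "rarr t 2 j = bid_val I j" "rarr t 2 k = bid_val I k"
      using input_kept_simps(4)[OF kept[OF t(2)]] ijk by simp_all
    have small: "small M (bid_val I j)" "small M (bid_val I k)"
      using small_state[OF t(1), of 2] bids by metis+
    show "run t (Seq (incr 4) (If (NLess (var 1) (var 4)) (RAssign 6 (var 4) (RGet 2 (var 3)))
        (RAssign 6 (var 4) (RGet 2 (var 2))))) (\<lambda>t'. ?Inv t' \<and> n_col I - narr t' 4 0 < n_col I - narr t 4 0)"
      using l n_col_le t vars bids small
      by (intro run_Seq run_incr run_If run_RAssign)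
        (auto simp: state_simps small_state le_Suc_eq)
  next
    fix t assume t: "?Inv t" "\<not> bval (NLess (var 4) col_exp) t"
    then show "(\<forall>a. a \<noteq> 4 \<longrightarrow> narr t a = narr s a) \<and>
      (\<forall>a. a \<noteq> 6 \<longrightarrow> rarr t a = rarr s a) \<and> load_vec (n_col I) 6 t = block_bid I i j k"
      using stop[OF t] by (auto simp: load_vec_def block_bid_def intro!: restrict_ext)
  qed (use bs n_col_le in \<open>auto simp: state_simps\<close>)
qed simp

lemma run_sum:
  assumes s: "bounded_state s" "input_kept I s" "bc \<in> bid_grid I"
    and ans: "\<And>l. l \<in> {1..n_col I} \<Longrightarrow> rarr s 7 l = exp_revenue I bc l"
      "\<And>l. l \<in> {1..n_col I} \<Longrightarrow> rarr s 8 l = exp_payment I bc l"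
  shows "run s sum_prog (\<lambda>t. (\<forall>a. a \<noteq> 4 \<longrightarrow> narr t a = narr s a) \<and>
    (\<forall>a. a \<noteq> 9 \<longrightarrow> rarr t a = rarr s a) \<and> rarr t 9 0 = weighted_utility I bc)"
  unfolding sum_prog_def
proof (rule run_Seq, rule run_NAssign[OF s(1)], simp, rule run_Seq, rule run_RAssign, assumption)
  let ?u = "\<lambda>l. \<Sum>i = 1..l. y_wt I i * exp_revenue I bc i - x_wt I * exp_payment I bc i"
  let ?Inv = "\<lambda>t. narr t 4 0 \<le> n_col I \<and> (\<forall>a. a \<noteq> 4 \<longrightarrow> narr t a = narr s a) \<and>
    (\<forall>a. a \<noteq> 9 \<longrightarrow> rarr t a = rarr s a) \<and> rarr t 9 0 = ?u (narr t 4 0)"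
  have kept: "input_kept I t" if "?Inv t" for t using s(2) that by (auto simp: input_kept_def)
  have stop: "narr t 4 0 = n_col I" if "?Inv t" "\<not> bval (NLess (var 4) col_exp) t" for t
    using that(2) conjunct1[OF that(1)] by (simp add: input_kept_simps(1)[OF kept[OF that(1)]])
  let ?s' = "nupd 4 (nval (NConst 0) s) (nval (NConst 0) s) s"
  show "small M (rval (RNat (NConst 0)) ?s')" using small_zero[OF M_pos] by simp
  assume bs: "bounded_state (rupd 9 (nval (NConst 0) ?s') (rval (RNat (NConst 0)) ?s') ?s')"
    (is "bounded_state ?s")
  show "run ?s (While (NLess (var 4) col_exp) (Seq (incr 4)
         (RAssign 9 (NConst 0) (RAdd (RGet 9 (NConst 0))
           (RSub (RMul (RGet 3 (var 4)) (RGet 7 (var 4)))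
             (RMul (RGet 4 (NConst 0)) (RGet 8 (var 4))))))))
     (\<lambda>t. (\<forall>a. a \<noteq> 4 \<longrightarrow> narr t a = narr s a) \<and>
    (\<forall>a. a \<noteq> 9 \<longrightarrow> rarr t a = rarr s a) \<and> rarr t 9 0 = weighted_utility I bc)"
  proof (rule run_While[where Inv = ?Inv and f = "\<lambda>t. n_col I - narr t 4 0"])
    fix t assume t: "bounded_state t" "?Inv t" "bval (NLess (var 4) col_exp) t"
    let ?l = "narr t 4 0"
    have l: "?l < n_col I" using t(3) input_kept_simps(1)[OF kept[OF t(2)]] by simp
    have vals: "rarr t 3 (Suc ?l) = y_wt I (Suc ?l)" "rarr t 4 0 = x_wt I"
      "rarr t 7 (Suc ?l) = exp_revenue I bc (Suc ?l)" "rarr t 8 (Suc ?l) = exp_payment I bc (Suc ?l)"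
      using input_kept_simps(5,6)[OF kept[OF t(2)]] ans l t(2) by simp_all
    have "small M (?u (Suc ?l))" using l by (intro small_partial_utility_M s) simp
    then have "small M (rarr t 9 0 + (y_wt I (Suc ?l) * exp_revenue I bc (Suc ?l) -
        x_wt I * exp_payment I bc (Suc ?l)))"
      using t(2) by simp
    then show "run t (Seq (incr 4) (RAssign 9 (NConst 0) (RAdd (RGet 9 (NConst 0))
           (RSub (RMul (RGet 3 (var 4)) (RGet 7 (var 4)))
             (RMul (RGet 4 (NConst 0)) (RGet 8 (var 4)))))))
        (\<lambda>t'. ?Inv t' \<and> n_col I - narr t' 4 0 < n_col I - narr t 4 0)"
      using l n_col_le t vals
      by (intro run_Seq run_incr run_RAssign) (auto simp: state_simps)
  next
    fix t assume t: "?Inv t" "\<not> bval (NLess (var 4) col_exp) t"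
    then show "(\<forall>a. a \<noteq> 4 \<longrightarrow> narr t a = narr s a) \<and>
      (\<forall>a. a \<noteq> 9 \<longrightarrow> rarr t a = rarr s a) \<and> rarr t 9 0 = weighted_utility I bc"
      using stop[OF t] by (simp add: weighted_utility_def)
  qed (use bs n_col_le in \<open>auto simp: state_simps\<close>)
qed

text \<open>The query is a point of the bid grid, hence a legal oracle input whose answers have
  lengths counted in the instance size.\<close>

lemma run_eval:
  assumes s: "bounded_state s" "input_kept I s"
    and ijk: "narr s 1 0 = i" "narr s 2 0 = j" "narr s 3 0 = k" "j \<in> {1..n_bids I}" "k \<in> {1..n_bids I}"
  shows "run s eval_prog (\<lambda>t. (\<forall>a. a \<noteq> 4 \<longrightarrow> narr t a = narr s a) \<and>
    (\<forall>a. a \<notin> {6..9} \<longrightarrow> rarr t a = rarr s a) \<and> rarr t 9 0 = F i j k)"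
  unfolding eval_prog_def
proof (rule run_Seq, rule run_mono[OF run_fill[OF s ijk]])
  let ?b = "block_bid I i j k"
  have grid: "?b \<in> bid_grid I" using ijk by (intro block_bid_in_grid)
  fix t assume t: "bounded_state t" "(\<forall>a. a \<noteq> 4 \<longrightarrow> narr t a = narr s a) \<and>
    (\<forall>a. a \<noteq> 6 \<longrightarrow> rarr t a = rarr s a) \<and> load_vec (n_col I) 6 t = ?b"
  let ?t = "store_vec (n_col I) 8 (exp_payment I ?b) (store_vec (n_col I) 7 (exp_revenue I ?b) t)"
  show "run t (Seq (Query 6 7 8) sum_prog) (\<lambda>t. (\<forall>a. a \<noteq> 4 \<longrightarrow> narr t a = narr s a) \<and>
    (\<forall>a. a \<notin> {6..9} \<longrightarrow> rarr t a = rarr s a) \<and> rarr t 9 0 = F i j k)"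
  proof (rule run_Seq, rule run_Query[OF t(1), of ?b])
    show "?b = load_vec (n_col I) 6 t" using t(2) by simp
    show "?b i \<in> {0..1}" if "i \<in> {1..n_col I}" for i by (rule bid_grid_range[OF valid grid that])
    show "small M (exp_revenue I ?b i) \<and> small M (exp_payment I ?b i)" if "i \<in> {1..n_col I}" for i
      using small_oracle[OF grid that] M(4) small_mono by blast
    assume bt: "bounded_state ?t"
    have kept: "input_kept I ?t" using s(2) t(2) by (auto simp: input_kept_def state_simps)
    show "run ?t sum_prog (\<lambda>t. (\<forall>a. a \<noteq> 4 \<longrightarrow> narr t a = narr s a) \<and>
      (\<forall>a. a \<notin> {6..9} \<longrightarrow> rarr t a = rarr s a) \<and> rarr t 9 0 = F i j k)"
      by (rule run_mono[OF run_sum[OF bt kept grid]])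
        (use t(2) in \<open>auto simp: state_simps F_def\<close>)
  qed
qed

definition candidate :: "nat \<Rightarrow> nat \<Rightarrow> nat \<Rightarrow> real" where
  "candidate i j k = gain I i j k + best_gain I (n_col I - Suc i) k"

lemma best_stepI:
  assumes "i < n_col I" "k \<in> {j..n_bids I}" "\<And>k'. k' \<in> {j..n_bids I} \<Longrightarrow> candidate i j k' \<le> candidate i j k"
  shows "best_gain I (n_col I - i) j = candidate i j k" "best_step I i j k"
proof -
  have i: "n_col I - i = Suc (n_col I - Suc i)" "n_col I - Suc (n_col I - Suc i) = i"
    using assms(1) by simp_all
  have "best_gain I (n_col I - i) j = Max (candidate i j ` {j..n_bids I})"
    unfolding i(1) best_gain.simps i(2) by (simp add: candidate_def)
  also have "\<dots> = candidate i j k" using assms(2,3) by (intro Max_eqI) auto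
  finally show eq: "best_gain I (n_col I - i) j = candidate i j k" .
  show "best_step I i j k" using assms(2) eq by (simp add: best_step_def candidate_def)
qed

text \<open>\<open>k\<close> is a best successor among those scanned so far. Outside cell
  \<open>j\<close>, array 11 is as on entry, which keeps the previous stage available.\<close>

definition step_inv :: "state \<Rightarrow> nat \<Rightarrow> nat \<Rightarrow> state \<Rightarrow> bool" where
  "step_inv s i j t \<longleftrightarrow> narr t 3 0 \<in> {j..n_bids I} \<and>
     (\<forall>a. a \<notin> {3, 4, 5} \<longrightarrow> narr t a = narr s a) \<and> (\<forall>a. a \<notin> {6..11} \<longrightarrow> rarr t a = rarr s a) \<and>
     rarr t 10 0 = F i j j \<and>
     (\<exists>k\<in>{j..narr t 3 0}. narr t 5 = (narr s 5)(i * (n_bids I + 1) + j := k) \<and>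
        rarr t 11 = (rarr s 11)(j := candidate i j k) \<and>
        (\<forall>k'\<in>{j..narr t 3 0}. candidate i j k' \<le> candidate i j k))"

lemma run_step_body:
  assumes kept: "input_kept I s"
    and ij: "narr s 1 0 = i" "narr s 2 0 = j" "i < n_col I" "j \<in> {1..n_bids I}"
    and gains: "\<And>k. k \<in> {j..n_bids I} \<Longrightarrow> rarr s 11 k = best_gain I (n_col I - Suc i) k"
    and t: "bounded_state t" "step_inv s i j t" "narr t 3 0 < n_bids I"
  shows "run t (Seq (incr 3) (Seq eval_prog
           (Seq (RAssign 9 (NConst 0)
               (RAdd (RSub (RGet 9 (NConst 0)) (RGet 10 (NConst 0))) (RGet 11 (var 3))))
             (If (RLess (RGet 11 (var 2)) (RGet 9 (NConst 0)))
               (Seq (RAssign 11 (var 2) (RGet 9 (NConst 0))) (NAssign 5 (cell_exp 2) (var 3)))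
               Skip))))
     (\<lambda>t'. step_inv s i j t' \<and> narr t' 3 0 = Suc (narr t 3 0))"
proof (rule run_Seq, rule run_incr[OF t(1)])
  let ?m = "Suc (narr t 3 0)" and ?Q = "\<lambda>t'. step_inv s i j t' \<and> narr t' 3 0 = Suc (narr t 3 0)"
  show "narr t 3 0 < M" using t(3) M(3) by simp
  let ?t = "nupd 3 0 (narr t 3 0 + 1) t"
  assume bt: "bounded_state ?t"
  have m: "?m \<in> {1..n_bids I}" "j < ?m" using t(2,3) by (auto simp: step_inv_def)
  obtain k where k: "k \<in> {j..narr t 3 0}" "narr t 5 = (narr s 5)(i * (n_bids I + 1) + j := k)"
      "rarr t 11 = (rarr s 11)(j := candidate i j k)"
      "\<And>k'. k' \<in> {j..narr t 3 0} \<Longrightarrow> candidate i j k' \<le> candidate i j k"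
    using t(2) by (auto simp: step_inv_def)
  have frame: "narr t a = narr s a" if "a \<notin> {3, 4, 5}" for a using t(2) that by (simp add: step_inv_def)
  have rframe: "rarr t a = rarr s a" if "a \<notin> {6..11}" for a using t(2) that by (simp add: step_inv_def)
  have kept_t: "input_kept I ?t" using kept frame rframe by (simp add: input_kept_def state_simps)
  show "run ?t (Seq eval_prog (Seq (RAssign 9 (NConst 0)
               (RAdd (RSub (RGet 9 (NConst 0)) (RGet 10 (NConst 0))) (RGet 11 (var 3))))
             (If (RLess (RGet 11 (var 2)) (RGet 9 (NConst 0)))
               (Seq (RAssign 11 (var 2) (RGet 9 (NConst 0))) (NAssign 5 (cell_exp 2) (var 3)))
               Skip))) ?Q"
  proof (rule run_Seq, rule run_mono[OF run_eval[OF bt kept_t, where i = i and j = j and k = ?m]])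
    show "narr ?t 1 0 = i" "narr ?t 2 0 = j" "narr ?t 3 0 = ?m" using ij frame by (simp_all add: state_simps)
    show "j \<in> {1..n_bids I}" "?m \<in> {1..n_bids I}" by fact+
    fix u assume u: "bounded_state u" "(\<forall>a. a \<noteq> 4 \<longrightarrow> narr u a = narr ?t a) \<and>
      (\<forall>a. a \<notin> {6..9} \<longrightarrow> rarr u a = rarr ?t a) \<and> rarr u 9 0 = F i j ?m"
    have u_vars: "narr u 1 0 = i" "narr u 2 0 = j" "narr u 3 0 = ?m"
      using u(2) ij frame by (simp_all add: state_simps)
    have u_arrs: "narr u 5 = narr t 5" "rarr u 10 0 = F i j j" "rarr u 11 = rarr t 11"
      using u(2) t(2) by (simp_all add: state_simps step_inv_def)
    have u_frame: "narr u a = narr s a" if "a \<notin> {3, 4, 5}" for a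
      using u(2) that frame by (simp add: state_simps)
    have u_rframe: "rarr u a = rarr s a" if "a \<notin> {6..11}" for a
    proof -
      have "a \<notin> {6..9}" using that by auto
      then have "rarr u a = rarr ?t a" using u(2) by blast
      then show ?thesis using rframe[OF that] by (simp add: state_simps)
    qed
    \<comment> \<open>\<open>?m\<close> exceeds \<open>j\<close>, so this cell has not been
      overwritten.\<close>
    have gain_m: "rarr u 11 ?m = best_gain I (n_col I - Suc i) ?m"
      using u_arrs(3) k(3) gains[of ?m] m by simp
    have val: "rval (RAdd (RSub (RGet 9 (NConst 0)) (RGet 10 (NConst 0))) (RGet 11 (var 3))) u =
        candidate i j ?m"
      using u(2) u_vars u_arrs(2) gain_m by (simp add: candidate_def gain_eq)
    let ?u = "rupd 9 0 (candidate i j ?m) u"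
    have cell: "nval (cell_exp 2) v = i * (n_bids I + 1) + j"
      if "\<And>a. a \<in> {0, 1, 2} \<Longrightarrow> narr v a = narr s a" for v
      using that kept ij by (simp add: cell_exp_def bids_exp_def input_kept_def input_state_def)
    show "run u (Seq (RAssign 9 (NConst 0)
               (RAdd (RSub (RGet 9 (NConst 0)) (RGet 10 (NConst 0))) (RGet 11 (var 3))))
             (If (RLess (RGet 11 (var 2)) (RGet 9 (NConst 0)))
               (Seq (RAssign 11 (var 2) (RGet 9 (NConst 0))) (NAssign 5 (cell_exp 2) (var 3)))
               Skip)) ?Q"
    proof (rule run_Seq, rule run_RAssign[OF u(1)], unfold val nval.simps)
      show small: "small M (candidate i j ?m)"
        unfolding candidate_def by (rule small_candidate[OF ij(4) m(1)]) simp
      assume bu: "bounded_state ?u"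
      show "run ?u (If (RLess (RGet 11 (var 2)) (RGet 9 (NConst 0)))
               (Seq (RAssign 11 (var 2) (RGet 9 (NConst 0))) (NAssign 5 (cell_exp 2) (var 3)))
               Skip) ?Q"
      proof (rule run_If[OF bu])
        assume "bval (RLess (RGet 11 (var 2)) (RGet 9 (NConst 0))) ?u"
        then have less: "candidate i j k < candidate i j ?m"
          using u_arrs(3) k(3) u_vars by (simp add: state_simps)
        let ?v = "rupd 11 j (candidate i j ?m) ?u"
        show "run ?u (Seq (RAssign 11 (var 2) (RGet 9 (NConst 0))) (NAssign 5 (cell_exp 2) (var 3))) ?Q"
        proof (rule run_Seq, rule run_RAssign[OF bu])
          show "small M (rval (RGet 9 (NConst 0)) ?u)" using small by (simp add: state_simps)
          have eq: "rupd 11 (nval (var 2) ?u) (rval (RGet 9 (NConst 0)) ?u) ?u = ?v"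
            using u_vars by (simp add: state_simps)
          assume "bounded_state (rupd 11 (nval (var 2) ?u) (rval (RGet 9 (NConst 0)) ?u) ?u)"
          then have bv: "bounded_state ?v" by (simp only: eq)
          have cell_v: "nval (cell_exp 2) ?v = i * (n_bids I + 1) + j"
            by (rule cell) (use u_frame in \<open>auto simp: state_simps\<close>)
          have *: "candidate i j k' \<le> candidate i j ?m" if "k' \<in> {j..?m}" for k'
            using that k(4)[of k'] less by (cases "k' = ?m") auto
          show "run (rupd 11 (nval (var 2) ?u) (rval (RGet 9 (NConst 0)) ?u) ?u)
              (NAssign 5 (cell_exp 2) (var 3)) ?Q"
            unfolding eq
            by (rule run_NAssign[OF bv], unfold cell_v)
              (use u_vars u_frame u_rframe u_arrs k(2,3) m * M(3) in
                \<open>auto simp: state_simps step_inv_def intro!: bexI[of _ ?m]\<close>)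
        qed
      next
        assume "\<not> bval (RLess (RGet 11 (var 2)) (RGet 9 (NConst 0))) ?u"
        then have less: "candidate i j ?m \<le> candidate i j k"
          using u_arrs(3) k(3) u_vars by (simp add: state_simps)
        have *: "candidate i j k' \<le> candidate i j k" if "k' \<in> {j..?m}" for k'
          using that k(4)[of k'] less by (cases "k' = ?m") auto
        show "run ?u Skip ?Q"
          by (rule run_Skip[OF bu])
            (use u_vars u_frame u_rframe u_arrs k(1-3) m * in
              \<open>auto simp: state_simps step_inv_def intro!: bexI[of _ k]\<close>)
      qed
    qed
  qed
qed

lemma run_step:
  assumes s: "bounded_state s" "input_kept I s"
    and ij: "narr s 1 0 = i" "narr s 2 0 = j" "i < n_col I" "j \<in> {1..n_bids I}"
    and gains: "\<And>k. k \<in> {j..n_bids I} \<Longrightarrow> rarr s 11 k = best_gain I (n_col I - Suc i) k"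
  shows "run s step_prog (\<lambda>t. (\<forall>a. a \<notin> {3, 4, 5} \<longrightarrow> narr t a = narr s a) \<and>
    (\<forall>a. a \<notin> {6..11} \<longrightarrow> rarr t a = rarr s a) \<and>
    (\<exists>k. best_step I i j k \<and> narr t 5 = (narr s 5)(i * (n_bids I + 1) + j := k)) \<and>
    rarr t 11 = (rarr s 11)(j := best_gain I (n_col I - i) j))"
    (is "run s step_prog ?Q")
  unfolding step_prog_def
proof (rule run_Seq, rule run_NAssign[OF s(1)], unfold nval.simps ij)
  let ?W = "While (NLess (var 3) bids_exp) (Seq (incr 3) (Seq eval_prog
           (Seq (RAssign 9 (NConst 0)
               (RAdd (RSub (RGet 9 (NConst 0)) (RGet 10 (NConst 0))) (RGet 11 (var 3))))
             (If (RLess (RGet 11 (var 2)) (RGet 9 (NConst 0)))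
               (Seq (RAssign 11 (var 2) (RGet 9 (NConst 0))) (NAssign 5 (cell_exp 2) (var 3)))
               Skip))))"
  let ?s = "nupd 3 0 j s"
  show "j \<le> M" using ij(4) M(3) by simp
  assume bs: "bounded_state ?s"
  have kept: "input_kept I ?s" using s(2) by (simp add: input_kept_def state_simps)
  show "run ?s (Seq eval_prog (Seq (RAssign 10 (NConst 0) (RGet 9 (NConst 0)))
      (Seq (NAssign 5 (cell_exp 2) (var 2)) ?W))) ?Q"
  proof (rule run_Seq, rule run_mono[OF run_eval[OF bs kept, where i = i and j = j and k = j]])
    show "narr ?s 1 0 = i" "narr ?s 2 0 = j" "narr ?s 3 0 = j" using ij by (simp_all add: state_simps)
    show "j \<in> {1..n_bids I}" "j \<in> {1..n_bids I}" by fact+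
    fix t assume t: "bounded_state t" "(\<forall>a. a \<noteq> 4 \<longrightarrow> narr t a = narr ?s a) \<and>
      (\<forall>a. a \<notin> {6..9} \<longrightarrow> rarr t a = rarr ?s a) \<and> rarr t 9 0 = F i j j"
    let ?t = "rupd 10 0 (F i j j) t"
    let ?u = "nupd 5 (i * (n_bids I + 1) + j) j ?t"
    have eqs: "rval (RGet 9 (NConst 0)) t = F i j j" "nval (var 2) ?t = j"
      using t(2) ij by (simp_all add: state_simps)
    have "input_kept I ?t" using t(2) kept by (simp add: input_kept_def state_simps)
    then have cell: "nval (cell_exp 2) ?t = i * (n_bids I + 1) + j"
      using t(2) ij by (simp add: input_kept_simps(3) state_simps)
    \<comment> \<open>Array 11 has not been written yet; by this identity its old cell
      \<open>j\<close> satisfies the invariant.\<close>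
    have "candidate i j j = best_gain I (n_col I - Suc i) j" by (simp add: candidate_def gain_eq)
    then have "rarr s 11 = (rarr s 11)(j := candidate i j j)" using gains[of j] ij(4) by auto
    then have inv: "step_inv s i j ?u"
      using t(2) ij(4) unfolding step_inv_def by (auto simp: state_simps)
    show "run t (Seq (RAssign 10 (NConst 0) (RGet 9 (NConst 0)))
      (Seq (NAssign 5 (cell_exp 2) (var 2)) ?W)) ?Q"
    proof (rule run_Seq, rule run_RAssign[OF t(1)], unfold eqs nval.simps(1))
      show "small M (F i j j)" using small_state[OF t(1), of 9 0] t(2) by simp
      assume bt: "bounded_state ?t"
      show "run ?t (Seq (NAssign 5 (cell_exp 2) (var 2)) ?W) ?Q"
      proof (rule run_Seq, rule run_NAssign[OF bt], unfold cell eqs(2))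
        show "j \<le> M" by fact
        assume bu: "bounded_state ?u"
        have inv_kept: "input_kept I v" if "step_inv s i j v" for v
          using s(2) that by (simp add: input_kept_def step_inv_def)
        show "run ?u ?W ?Q"
        proof (rule run_While[OF bu, where Inv = "step_inv s i j" and f = "\<lambda>v. n_bids I - narr v 3 0"])
          fix v assume v: "bounded_state v" "step_inv s i j v"
          note bids = input_kept_simps(2)[OF inv_kept[OF v(2)]]
          show "run v (Seq (incr 3) (Seq eval_prog
           (Seq (RAssign 9 (NConst 0)
               (RAdd (RSub (RGet 9 (NConst 0)) (RGet 10 (NConst 0))) (RGet 11 (var 3))))
             (If (RLess (RGet 11 (var 2)) (RGet 9 (NConst 0)))
               (Seq (RAssign 11 (var 2) (RGet 9 (NConst 0))) (NAssign 5 (cell_exp 2) (var 3)))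
               Skip)))) (\<lambda>v'. step_inv s i j v' \<and> n_bids I - narr v' 3 0 < n_bids I - narr v 3 0)"
            if "bval (NLess (var 3) bids_exp) v"
          proof -
            have less: "narr v 3 0 < n_bids I" using that bids by simp
            show ?thesis
              by (rule run_mono[OF run_step_body[OF s(2) ij gains v less]]) (use less in auto)
          qed
          show "?Q v" if "\<not> bval (NLess (var 3) bids_exp) v"
          proof -
            have m: "narr v 3 0 = n_bids I" using that bids v(2) by (simp add: step_inv_def)
            obtain k where k: "k \<in> {j..n_bids I}" "narr v 5 = (narr s 5)(i * (n_bids I + 1) + j := k)"
              "rarr v 11 = (rarr s 11)(j := candidate i j k)"
              "\<And>k'. k' \<in> {j..n_bids I} \<Longrightarrow> candidate i j k' \<le> candidate i j k"
              using v(2) m by (auto simp: step_inv_def)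
            from best_stepI[OF ij(3) k(1,4)] show ?thesis
              using v(2) k(2,3) by (auto simp: step_inv_def)
          qed
        qed (use inv M(3) in auto)
      qed
    qed
  qed
qed

text \<open>Array 11 is split at the current index into new values and those of the previous stage.
  The last clause protects the rows of positions already finished.\<close>

definition stage_inv :: "state \<Rightarrow> nat \<Rightarrow> state \<Rightarrow> bool" where
  "stage_inv s i t \<longleftrightarrow> narr t 2 0 \<le> n_bids I \<and>
     (\<forall>a. a \<notin> {2..5} \<longrightarrow> narr t a = narr s a) \<and> (\<forall>a. a \<notin> {6..11} \<longrightarrow> rarr t a = rarr s a) \<and>
     (\<forall>j\<in>{1..n_bids I}. rarr t 11 j =
        (if j \<le> narr t 2 0 then best_gain I (n_col I - i) j else best_gain I (n_col I - Suc i) j)) \<and>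
     (\<forall>j\<in>{1..narr t 2 0}. best_step I i j (narr t 5 (i * (n_bids I + 1) + j))) \<and>
     (\<forall>i'. i' \<noteq> i \<longrightarrow> (\<forall>j\<in>{1..n_bids I}.
        narr t 5 (i' * (n_bids I + 1) + j) = narr s 5 (i' * (n_bids I + 1) + j)))"

lemma run_stage:
  assumes s: "bounded_state s" "input_kept I s" and i: "narr s 1 0 = i" "i < n_col I"
    and gains: "\<And>j. j \<in> {1..n_bids I} \<Longrightarrow> rarr s 11 j = best_gain I (n_col I - Suc i) j"
  shows "run s stage_prog (\<lambda>t. stage_inv s i t \<and> narr t 2 0 = n_bids I)"
  unfolding stage_prog_def
proof (rule run_Seq, rule run_NAssign[OF s(1)], simp, unfold nval.simps)
  let ?s = "nupd 2 0 0 s"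
  assume bs: "bounded_state ?s"
  have inv: "stage_inv s i ?s" using gains by (simp add: stage_inv_def state_simps)
  have kept: "input_kept I t" if "stage_inv s i t" for t
    using s(2) that by (simp add: input_kept_def stage_inv_def)
  show "run ?s (While (NLess (var 2) bids_exp) (Seq (incr 2) step_prog))
    (\<lambda>t. stage_inv s i t \<and> narr t 2 0 = n_bids I)"
  proof (rule run_While[where Inv = "stage_inv s i" and f = "\<lambda>t. n_bids I - narr t 2 0", OF bs inv])
    show "n_bids I - narr ?s 2 0 \<le> M" using M(3) by simp
  next
    fix t assume t: "bounded_state t" "stage_inv s i t" "bval (NLess (var 2) bids_exp) t"
    let ?j = "Suc (narr t 2 0)" and ?t = "nupd 2 0 (narr t 2 0 + 1) t"
    have j: "?j \<in> {1..n_bids I}" using t(3) input_kept_simps(2)[OF kept[OF t(2)]] by simp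
    show "run t (Seq (incr 2) step_prog)
        (\<lambda>t'. stage_inv s i t' \<and> n_bids I - narr t' 2 0 < n_bids I - narr t 2 0)"
    proof (rule run_Seq, rule run_incr[OF t(1)])
      show "narr t 2 0 < M" using j M(3) by simp
      assume bt: "bounded_state ?t"
      have kept_t: "input_kept I ?t" using kept[OF t(2)] by (simp add: input_kept_def state_simps)
      have vars: "narr ?t 1 0 = i" "narr ?t 2 0 = ?j" using t(2) i(1) by (simp_all add: stage_inv_def state_simps)
      have g: "rarr ?t 11 k = best_gain I (n_col I - Suc i) k" if "k \<in> {?j..n_bids I}" for k
        using t(2) that by (simp add: stage_inv_def state_simps)
      show "run ?t step_prog (\<lambda>t'. stage_inv s i t' \<and> n_bids I - narr t' 2 0 < n_bids I - narr t 2 0)"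
      proof (rule run_mono[OF run_step[OF bt kept_t vars i(2) j g]], assumption, elim conjE exE)
        fix u :: state and k
        assume na: "\<forall>a. a \<notin> {3, 4, 5} \<longrightarrow> narr u a = narr ?t a"
          and ra: "\<forall>a. a \<notin> {6..11} \<longrightarrow> rarr u a = rarr ?t a"
          and k: "best_step I i ?j k"
          and n5: "narr u 5 = (narr ?t 5)(i * (n_bids I + 1) + ?j := k)"
          and r11: "rarr u 11 = (rarr ?t 11)(?j := best_gain I (n_col I - i) ?j)"
        \<comment> \<open>Separates the cell just written from all other table entries.\<close>
        have cell: "i' * (n_bids I + 1) + j' = i * (n_bids I + 1) + ?j \<longleftrightarrow> i' = i \<and> j' = ?j"
          if "j' \<le> n_bids I" for i' j'
          using that j by (intro cell_eq_iff) simp_all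
        have u2: "narr u 2 0 = ?j" using na by (simp add: state_simps)
        have t5: "narr ?t 5 = narr t 5" "rarr ?t 11 = rarr t 11" by (simp_all add: state_simps)
        have "stage_inv s i u"
          unfolding stage_inv_def u2
        proof (intro conjI)
          show "?j \<le> n_bids I" using j by simp
          show "\<forall>a. a \<notin> {2..5} \<longrightarrow> narr u a = narr s a"
            using na t(2) by (auto simp: stage_inv_def state_simps)
          show "\<forall>a. a \<notin> {6..11} \<longrightarrow> rarr u a = rarr s a"
            using ra t(2) unfolding stage_inv_def rarr_nupd by metis
          show "\<forall>j\<in>{1..n_bids I}. rarr u 11 j =
              (if j \<le> ?j then best_gain I (n_col I - i) j else best_gain I (n_col I - Suc i) j)"
            using t(2) unfolding r11 t5 stage_inv_def by (auto simp: le_Suc_eq)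
          show "\<forall>j\<in>{1..?j}. best_step I i j (narr u 5 (i * (n_bids I + 1) + j))"
          proof
            fix j' assume j': "j' \<in> {1..?j}"
            show "best_step I i j' (narr u 5 (i * (n_bids I + 1) + j'))"
            proof (cases "j' = ?j")
              case False
              then have "j' \<in> {1..narr t 2 0}" "j' \<le> n_bids I" using j j' by auto
              then show ?thesis
                using t(2) False cell[of j' i] unfolding n5 t5 stage_inv_def by simp
            qed (simp add: n5 k)
          qed
          show "\<forall>i'. i' \<noteq> i \<longrightarrow> (\<forall>j\<in>{1..n_bids I}.
              narr u 5 (i' * (n_bids I + 1) + j) = narr s 5 (i' * (n_bids I + 1) + j))"
          proof (intro allI impI ballI)
            fix i' j' assume ij': "i' \<noteq> i" "j' \<in> {1..n_bids I}"
            then show "narr u 5 (i' * (n_bids I + 1) + j') = narr s 5 (i' * (n_bids I + 1) + j')"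
              using t(2) cell[of j' i'] unfolding n5 t5 stage_inv_def by simp
          qed
        qed
        then show "stage_inv s i u \<and> n_bids I - narr u 2 0 < n_bids I - narr t 2 0"
          using j u2 by simp
      qed
    qed
  next
    fix t assume t: "stage_inv s i t" "\<not> bval (NLess (var 2) bids_exp) t"
    then have "n_bids I \<le> narr t 2 0" by (simp add: input_kept_simps(2)[OF kept[OF t(1)]])
    then show "stage_inv s i t \<and> narr t 2 0 = n_bids I" using t(1) by (simp add: stage_inv_def)
  qed
qed

definition table_inv :: "state \<Rightarrow> bool" where
  "table_inv t \<longleftrightarrow> input_kept I t \<and> narr t 1 0 \<le> n_col I \<and>
     (\<forall>j\<in>{1..n_bids I}. rarr t 11 j = best_gain I (n_col I - narr t 1 0) j) \<and>
     (\<forall>i\<in>{narr t 1 0..<n_col I}. \<forall>j\<in>{1..n_bids I}.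
        best_step I i j (narr t 5 (i * (n_bids I + 1) + j)))"

lemma run_table:
  assumes s: "bounded_state s" "input_kept I s" and gains: "\<And>j. rarr s 11 j = 0"
  shows "run s table_prog (\<lambda>t. input_kept I t \<and> (\<forall>i<n_col I. \<forall>j\<in>{1..n_bids I}.
    best_step I i j (narr t 5 (i * (n_bids I + 1) + j))))"
  unfolding table_prog_def
proof (rule run_Seq, rule run_NAssign[OF s(1)], unfold input_kept_simps(1)[OF s(2)] nval.simps)
  let ?s = "nupd 1 0 (n_col I) s"
  show "n_col I \<le> M" by (rule n_col_le)
  assume bs: "bounded_state ?s"
  have inv: "table_inv ?s" using s(2) gains by (simp add: table_inv_def input_kept_def state_simps)
  show "run ?s (While (NLess (NConst 0) (var 1))
      (Seq (NAssign 1 (NConst 0) (NSub (var 1) (NConst 1))) stage_prog))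
    (\<lambda>t. input_kept I t \<and> (\<forall>i<n_col I. \<forall>j\<in>{1..n_bids I}.
      best_step I i j (narr t 5 (i * (n_bids I + 1) + j))))"
  proof (rule run_While[where Inv = table_inv and f = "\<lambda>t. narr t 1 0", OF bs inv])
    show "narr ?s 1 0 \<le> M" by (rule nat_state[OF bs])
  next
    fix t assume t: "bounded_state t" "table_inv t" "bval (NLess (NConst 0) (var 1)) t"
    define i where "i = narr t 1 0 - 1"
    have "0 < narr t 1 0" "narr t 1 0 \<le> n_col I" using t(2,3) by (simp_all add: table_inv_def)
    then have i: "narr t 1 0 = Suc i" "i < n_col I" unfolding i_def by linarith+
    let ?t = "nupd 1 0 i t"
    have eq: "nval (NSub (var 1) (NConst 1)) t = i" by (simp add: i_def)
    show "run t (Seq (NAssign 1 (NConst 0) (NSub (var 1) (NConst 1))) stage_prog)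
        (\<lambda>t'. table_inv t' \<and> narr t' 1 0 < narr t 1 0)"
    proof (rule run_Seq, rule run_NAssign[OF t(1)], unfold eq nval.simps(1))
      show "i \<le> M" using i(2) n_col_le by simp
      assume bt: "bounded_state ?t"
      have kept: "input_kept I ?t" and i_t: "narr ?t 1 0 = i"
        using t(2) by (simp_all add: table_inv_def input_kept_def state_simps)
      have g: "rarr ?t 11 j = best_gain I (n_col I - Suc i) j" if "j \<in> {1..n_bids I}" for j
        using t(2) that i(1) by (simp add: table_inv_def state_simps)
      show "run ?t stage_prog (\<lambda>t'. table_inv t' \<and> narr t' 1 0 < narr t 1 0)"
      proof (rule run_mono[OF run_stage[OF bt kept i_t i(2) g]], assumption, elim conjE)
        fix u assume u: "stage_inv ?t i u" "narr u 2 0 = n_bids I"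
        have u1: "narr u 1 0 = i" using u(1) i_t by (simp add: stage_inv_def)
        have "input_kept I u" using u(1) kept by (simp add: stage_inv_def input_kept_def)
        moreover have "rarr u 11 j = best_gain I (n_col I - i) j" if "j \<in> {1..n_bids I}" for j
          using u that by (simp add: stage_inv_def)
        moreover have "best_step I i' j (narr u 5 (i' * (n_bids I + 1) + j))"
          if "i' \<in> {i..<n_col I}" "j \<in> {1..n_bids I}" for i' j
        proof (cases "i' = i")
          case True
          then show ?thesis using u that(2) by (simp add: stage_inv_def)
        next
          case False
          then have "narr u 5 (i' * (n_bids I + 1) + j) = narr t 5 (i' * (n_bids I + 1) + j)"
            using u(1) that(2) by (simp add: stage_inv_def state_simps)
          then show ?thesis using t(2) that False i(1) by (simp add: table_inv_def)
        qed
        ultimately show "table_inv u \<and> narr u 1 0 < narr t 1 0"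
          using i unfolding table_inv_def u1 by simp
      qed
    qed
  next
    fix t assume "table_inv t" "\<not> bval (NLess (NConst 0) (var 1)) t"
    then show "input_kept I t \<and> (\<forall>i<n_col I. \<forall>j\<in>{1..n_bids I}.
        best_step I i j (narr t 5 (i * (n_bids I + 1) + j)))"
      by (simp add: table_inv_def)
  qed
qed

primrec best_path :: "state \<Rightarrow> nat \<Rightarrow> nat" where
  "best_path s 0 = 1"
| "best_path s (Suc i) = narr s 5 (i * (n_bids I + 1) + best_path s i)"

lemma run_output:
  assumes s: "bounded_state s" "input_kept I s"
    and steps: "\<And>i j. i < n_col I \<Longrightarrow> j \<in> {1..n_bids I} \<Longrightarrow>
      best_step I i j (narr s 5 (i * (n_bids I + 1) + j))"
  shows "run s output_prog (\<lambda>t. output_strategy I t = path_bid I (best_path s))"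
  unfolding output_prog_def
proof (rule run_Seq, rule run_NAssign[OF s(1)], use M_pos in simp, rule run_Seq, rule run_NAssign, assumption, simp)
  let ?p = "best_path s"
  \<comment> \<open>\<open>narr t 5\<close> is the table and \<open>rarr t 5\<close> the output:
    arrays of different sorts that share a number, so writing the output leaves the table
    intact.\<close>
  let ?Inv = "\<lambda>t. input_kept I t \<and> narr t 5 = narr s 5 \<and> narr t 1 0 \<le> n_col I \<and>
    narr t 6 0 = ?p (narr t 1 0) \<and> (\<forall>l\<in>{1..narr t 1 0}. rarr t 5 l = bid_val I (?p l))"
  let ?s' = "nupd 6 (nval (NConst 0) s) (nval (NConst 1) s) s"
  let ?s = "nupd 1 (nval (NConst 0) ?s') (nval (NConst 0) ?s') ?s'"
  assume bs: "bounded_state ?s"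
  have p: "?p i \<in> {1..n_bids I}" if "i \<le> n_col I" for i
    using that
  proof (induction i)
    case (Suc i)
    then have "?p (Suc i) \<in> {?p i..n_bids I}" using steps[of i "?p i"] by (simp add: best_step_def)
    then show ?case using Suc by simp
  qed (use n_bids_pos in simp)
  show "run ?s (While (NLess (var 1) col_exp)
       (Seq (NAssign 6 (NConst 0) (NGet 5 (cell_exp 6)))
         (Seq (incr 1) (RAssign 5 (var 1) (RGet 2 (var 6))))))
     (\<lambda>t. output_strategy I t = path_bid I ?p)"
  proof (rule run_While[OF bs, where Inv = ?Inv and f = "\<lambda>t. n_col I - narr t 1 0"])
    show "?Inv ?s" using s(2) by (simp add: input_kept_def state_simps)
    show "n_col I - narr ?s 1 0 \<le> M" using n_col_le by simp
  next
    fix t assume t: "bounded_state t" "?Inv t" "bval (NLess (var 1) col_exp) t"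
    let ?i = "narr t 1 0"
    have i: "?i < n_col I" using t(2,3) input_kept_simps(1)[of I t] by simp
    have val: "nval (NGet 5 (cell_exp 6)) t = ?p (Suc ?i)"
      using t(2) input_kept_simps(3)[of I t 6] by simp
    have bid: "rarr t 2 (?p (Suc ?i)) = bid_val I (?p (Suc ?i))"
      using input_kept_simps(4)[of I t] t(2) p[of "Suc ?i"] i by simp
    let ?t = "nupd 6 0 (?p (Suc ?i)) t"
    show "run t (Seq (NAssign 6 (NConst 0) (NGet 5 (cell_exp 6)))
         (Seq (incr 1) (RAssign 5 (var 1) (RGet 2 (var 6)))))
        (\<lambda>t'. ?Inv t' \<and> n_col I - narr t' 1 0 < n_col I - narr t 1 0)"
    proof (rule run_Seq, rule run_NAssign[OF t(1)], unfold val nval.simps(1))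
      show "?p (Suc ?i) \<le> M" using p[of "Suc ?i"] i M(3) by simp
      assume bt: "bounded_state ?t"
      show "run ?t (Seq (incr 1) (RAssign 5 (var 1) (RGet 2 (var 6))))
        (\<lambda>t'. ?Inv t' \<and> n_col I - narr t' 1 0 < n_col I - narr t 1 0)"
      proof (rule run_Seq, rule run_incr[OF bt])
        show "narr ?t 1 0 < M" using i n_col_le by (simp add: state_simps)
        let ?u = "nupd 1 0 (narr ?t 1 0 + 1) ?t"
        assume bu: "bounded_state ?u"
        show "run ?u (RAssign 5 (var 1) (RGet 2 (var 6)))
          (\<lambda>t'. ?Inv t' \<and> n_col I - narr t' 1 0 < n_col I - narr t 1 0)"
        proof (rule run_RAssign[OF bu])
          show "small M (rval (RGet 2 (var 6)) ?u)" using small_state[OF bu] by simp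
        qed (use t(2) i bid in \<open>auto simp: state_simps input_kept_def le_Suc_eq simp del: best_path.simps(2)\<close>)
      qed
    qed
  next
    fix t assume t: "?Inv t" "\<not> bval (NLess (var 1) col_exp) t"
    then have "narr t 1 0 = n_col I" using input_kept_simps(1)[of I t] by simp
    then show "output_strategy I t = path_bid I ?p"
      using t(1) by (auto simp: output_strategy_def load_vec_def path_bid_def intro!: restrict_ext)
  qed
qed

lemma bounded_input: "bounded_state (input_state I)"
proof -
  have small: "small M x" if "x \<in> set (input_numbers I)" for x
    using small_mono[OF small_input[OF that] M(4)] .
  have "small M 0" using small_zero[OF M_pos] .
  moreover have "small M (slot_ctr I k)" if "k \<in> {1..n_slots I}" for k
    using that by (intro small) (auto simp: input_numbers_def simp del: upt_Suc)
  moreover have "small M (valuation I k)" if "k \<in> {1..n_agents I}" for k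
    using that by (intro small) (auto simp: input_numbers_def simp del: upt_Suc)
  moreover have "small M (bid_val I k)" if "k \<in> {1..n_bids I}" for k
    using that by (intro small) (auto simp: input_numbers_def simp del: upt_Suc)
  moreover have "small M (y_wt I k)" if "k \<in> {1..n_col I}" for k
    using that by (intro small) (auto simp: input_numbers_def simp del: upt_Suc)
  moreover have "small M (x_wt I)" by (intro small) (simp add: input_numbers_def)
  ultimately show ?thesis
    using M M_pos by (auto simp: bounded_state_def input_state_def n_agents_def split: mechanism.splits)
qed

lemma solves: "solves_in_time sz solver (cost_bound solver M) I"
proof -
  have "run (input_state I) solver (\<lambda>t. output_strategy I t \<in> bid_grid I \<and>
      weighted_utility I (output_strategy I t) = Max (weighted_utility I ` bid_grid I))"
    unfolding solver_def
  proof (rule run_Seq, rule run_mono[OF run_table[OF bounded_input]])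
    show "input_kept I (input_state I)" by (simp add: input_kept_def)
    show "rarr (input_state I) 11 j = 0" for j by (simp add: input_state_def)
    fix s assume s: "bounded_state s" "input_kept I s \<and> (\<forall>i<n_col I. \<forall>j\<in>{1..n_bids I}.
      best_step I i j (narr s 5 (i * (n_bids I + 1) + j)))"
    have "path_bid I (best_path s) \<in> bid_grid I"
      "weighted_utility I (path_bid I (best_path s)) = Max (weighted_utility I ` bid_grid I)"
      by (rule best_steps_optimal[OF valid]; use s(2) in simp)+
    moreover have "run s output_prog (\<lambda>t. output_strategy I t = path_bid I (best_path s))"
      using s by (intro run_output) blast+
    ultimately show "run s output_prog (\<lambda>t. output_strategy I t \<in> bid_grid I \<and>
      weighted_utility I (output_strategy I t) = Max (weighted_utility I ` bid_grid I))"
      by (elim run_mono) simp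
  qed
  then show ?thesis unfolding run_def solves_in_time_def by blast
qed

end

text \<open>The last bound on \<open>M\<close> in \<open>solver_run\<close> with all parameters
  replaced by the instance size, plus \<open>S\<close> to dominate \<open>n\<close>,
  \<open>m\<close>, \<open>d\<close> and \<open>L\<close>.\<close>

definition value_bound :: "nat \<Rightarrow> nat" where
  "value_bound S = (S + 1) * (2 * (4 * S * S + 1)) + 1 + S"

lemma solves_in_time_mono:
  "solves_in_time sz c T I \<Longrightarrow> T \<le> T' \<Longrightarrow> solves_in_time sz c T' I"
  unfolding solves_in_time_def using order_trans by blast

lemma solver_in_time:
  assumes "length_measure sz small" and valid: "valid_instance I"
    and small: "\<And>x. x \<in> set (input_numbers I) \<union> oracle_answers I \<Longrightarrow> small (sz x) x"
  shows "solves_in_time sz solver (cost_bound solver (value_bound (instance_size sz I))) I"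
proof -
  let ?S = "instance_size sz I"
  interpret length_measure sz small by fact
  have input: "sz x \<le> ?S" if "x \<in> set (input_numbers I)" for x
    using member_le_sum_list[of "sz x" "map sz (input_numbers I)"] that by (simp add: instance_size_def)
  \<comment> \<open>Finiteness ensures that the maximum in \<open>instance_size\<close> really
    dominates every answer.\<close>
  have "finite (oracle_answers I)"
    unfolding oracle_answers_def using finite_bid_grid by auto
  then have answers: "sz x \<le> ?S" if "x \<in> oracle_answers I" for x
  proof -
    have "sz x \<le> Max (insert 0 (sz ` oracle_answers I))"
      using that \<open>finite (oracle_answers I)\<close> by (intro Max_ge) auto
    then show ?thesis by (simp add: instance_size_def)
  qed
  have n: "n_col I \<le> ?S" "n_agents I \<le> ?S" "n_slots I \<le> ?S" "n_bids I \<le> ?S"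
    by (simp_all add: instance_size_def n_agents_def)
  interpret solver_run sz small I "value_bound ?S" ?S
  proof
    show "small ?S x" if "x \<in> set (input_numbers I)" for x
      using small_mono[OF small input[OF that]] that by simp
    show "small ?S x" if "x \<in> oracle_answers I" for x
      using small_mono[OF small answers[OF that]] that by simp
    have "(n_col I + 1) * (2 * (4 * ?S * n_col I + 1)) \<le> (?S + 1) * (2 * (4 * ?S * ?S + 1))"
      using n(1) by (intro mult_le_mono add_le_mono) simp_all
    then show "(n_col I + 1) * (2 * (4 * ?S * n_col I + 1)) + 1 \<le> value_bound ?S"
      by (simp add: value_bound_def)
  qed (use n valid in \<open>simp_all add: value_bound_def\<close>)
  show ?thesis by (rule solves)
qed

theorem theorem2:
  shows "\<exists>(c :: com) (p :: nat poly). \<forall>I. valid_instance I \<longrightarrow>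
    solves_in_time unit_len c (poly p (instance_size unit_len I)) I \<and>
    (rational_instance I \<longrightarrow>
      solves_in_time rat_len c (poly p (instance_size rat_len I)) I)"
proof -
  \<comment> \<open>This bound does not mention the length measure, so one polynomial serves both
    cost models.\<close>
  have "poly_bounded (\<lambda>S. cost_bound solver (value_bound S))"
    unfolding value_bound_def
    by (intro poly_bounded_compose[OF poly_bounded_cost_bound] poly_bounded_intros)
  then obtain p :: "nat poly" where p: "cost_bound solver (value_bound S) \<le> poly p S" for S
    by (auto simp: poly_bounded_def)
  show ?thesis
  proof (intro exI[of _ solver] exI[of _ p] allI impI conjI)
    fix I assume I: "valid_instance I"
    show "solves_in_time unit_len solver (poly p (instance_size unit_len I)) I"
      by (rule solves_in_time_mono[OF solver_in_time[OF length_measure_unit I] p]) simp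
    assume "rational_instance I"
    then show "solves_in_time rat_len solver (poly p (instance_size rat_len I)) I"
      by (intro solves_in_time_mono[OF solver_in_time[OF length_measure_rat I] p] rat_small_rat_len)
        (auto simp: rational_instance_def)
  qed
qed

end
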